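(* Consider $N\ge 2$ agents $\dot x_i=Ax_i+Bu_i$, $x_i(t)\in\mathbb{R}^n$, $u_i(t)\in\mathbb{R}^m$, on a fixed directed communication graph $\mathcal{G}$, with the event-triggered, model-based control scheme described in the context (without communication delays). Assume that $\mathcal{G}$ has a directed spanning tree and that the pair $(A,B)$ is controllable. Let $\alpha>0$, let $P$ be a symmetric positive definite solution of $$PA+A^TP-2PBB^TP+2\alpha P<0,$$ and let $F=-B^TP$ and $c\ge 1/\mathrm{Re}(\lambda_2)$. Let $\hat A=I_{N-1}\otimes A+cJ_{2:N}\otimes BF$, and let $\hat\beta>0$, $\hat\lambda>0$ be such that $\|e^{\hat A t}\|\le\hat\beta e^{-\hat\lambda t}$ for all $t\ge 0$. Let the events be triggered with the thresholds $\|e_i(t)\|=\beta e^{-\lambda t}$, $i=1,\dots,N$, where $\beta>0$ and $0<\lambda<\hat\lambda$. Then, for every initial condition, the agents achieve consensus asymptotically, i.e. $\lim_{t\to\infty}\|x_i(t)-x_j(t)\|=0$ for all $i,j\in\{1,\dots,N\}$. Furthermore, the agents do not exhibit Zeno behavior, and for every agent $i=1,\dots,N$ and any two consecutive event times $t_{k_i}<t_{k_i+1}$ of agent $i$, $$0<\tau\le t_{k_i+1}-t_{k_i},\qquad \tau=\frac{\ln(1+\beta/K_3)}{\|A\|+\hat\lambda},$$ where the positive parameter $K_3$ (which depends on $t_{k_i}$) is $$K_3=\|cBF\|\left(\frac{K_1e^{(\lambda-\hat\lambda)t_{k_i}}}{\|A\|+\hat\lambda}+\frac{K_2}{\|A\|+\lambda}\right),$$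 $$K_1=\hat\Theta\left(\hat\beta\hat x_0-\frac{\sqrt N\beta\hat\beta\|\hat B\|}{\hat\lambda-\lambda}\right),\qquad K_2=\hat\Theta\,\frac{\sqrt N\beta\hat\beta\|\hat B\|}{\hat\lambda-\lambda}+\|\mathcal{L}\|\sqrt N\beta .$$
   Context: Norms are Euclidean norms of vectors and the induced (spectral) norms of matrices; $\otimes$ is the Kronecker product; $I_k$ is the identity matrix of size $k$; $0_k$ is the zero column vector of length $k$. Graph. $\mathcal{G}=(\mathcal{V},\mathcal{E})$ is a directed graph with $\mathcal{V}=\{1,\dots,N\}$; $(i,j)\in\mathcal{E}$ means that agent $j$ receives information from agent $i$, and then $i$ is called a neighbor of $j$. $\mathcal{N}_j$ is the set of neighbors of $j$. $\mathcal{G}$ has a directed spanning tree if at least one agent has directed paths to all other agents. The adjacency matrix has $a_{ij}=1$ if $(j,i)\in\mathcal{E}$ and $a_{ij}=0$ otherwise; the Laplacian is $\mathcal{L}=\mathcal{D}-\mathcal{A}$ with $\mathcal{D}$ diagonal, $d_{ii}=\sum_{j\in\mathcal{N}_i}a_{ij}$. When $\mathcal{G}$ has a directed spanning tree, $\mathcal{L}$ has a simple eigenvalue $\lambda_1=0$ and its other eigenvalues have positive real part; $\lambda_2$ denotes one of these other eigenvalues with smallest real part. Control scheme. $A\in\mathbb{R}^{n\times n}$, $B\in\mathbb{R}^{n\times m}$, $F\in\mathbb{R}^{m\times n}$, $c\in\mathbb{R}$. The inputs are $$u_i(t)=cF\sum_{j\in\mathcal{N}_i}(y_i(t)-y_j(t)),$$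 where the model state $y_i$ satisfies $\dot y_i(t)=Ay_i(t)$ for $t\in[t_{k_i},t_{k_i+1})$ and is reset by $y_i(t_{k_i})=x_i(t_{k_i})$ at each event time $t_{k_i}$ of agent $i$. The first event time of every agent is $0$ (so $y_i(0)=x_i(0)$). The local error is $e_i(t)=y_i(t)-x_i(t)$; after an event at $t_{k_i}$ (where $e_i$ is reset to zero), the next event time $t_{k_i+1}$ is the first time $t>t_{k_i}$ at which the error of the not-yet-reset model reaches the threshold, $\|e_i(t)\|=\beta e^{-\lambda t}$ (if this never happens, agent $i$ has no further events). Zeno behavior means infinitely many events of some agent in a bounded time interval. Transformed quantities. Let $S_L$ be an invertible complex matrix such that $$S_L^{-1}\mathcal{L}S_L=\begin{bmatrix} 0 & 0_{N-1}^T \\ 0_{N-1} & J_{2:N} \end{bmatrix}$$ is in Jordan canonical form, where $J_{2:N}\in\mathbb{C}^{(N-1)\times(N-1)}$ consists of the Jordan blocks of the nonzero eigenvalues of $\mathcal{L}$. Put $x=[x_1^T\ \cdots\ x_N^T]^T$, $\hat x=(S_L\otimes I_n)^{-1}x$, let $\hat x_{2:N}$ be the vector of the last $(N-1)n$ entries of $\hat x$, and $\hat x_0=\|\hat x_{2:N}(0)\|$. Put $\Delta=[\,0_{N-1}\ \ J_{2:N}\,]S_L^{-1}\in\mathbb{C}^{(N-1)\times N}$, $\hat B=c\Delta\otimes BF$, $\Theta=S_L\begin{bmatrix} 0_{N-1}^T \\ J_{2:N} \end{bmatrix}\in\mathbb{C}^{N\times(N-1)}$, and $\hat\Theta=\|\Theta\|$.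 *)

theory Defs
  imports "HOL-Analysis.Analysis" "Jordan_Normal_Form.Jordan_Normal_Form"
begin

no_notation Matrix.vec_index (infixl \<open>$\<close> 100)
no_notation Matrix.scalar_prod (infix \<open>\<bullet>\<close> 70)
hide_const (open) Matrix.mat Matrix.vec Matrix.row Matrix.col List.transpose

section \<open>Matrices over finite index types\<close>

definition cmat :: "real^'b^'a \<Rightarrow> complex^'b^'a" where
  "cmat M = (\<chi> i j. complex_of_real (M $ i $ j))"

definition mat_norm :: "('a::real_normed_field)^'c^'b \<Rightarrow> real" where
  "mat_norm M = onorm (\<lambda>v. M *v v)"

definition kron :: "('a::times)^'c^'b \<Rightarrow> 'a^'e^'d \<Rightarrow> 'a^('c \<times> 'e)^('b \<times> 'd)" where
  "kron M M' = (\<chi> p q. M $ fst p $ fst q * M' $ snd p $ snd q)"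

definition mat_exp :: "('a::real_normed_field)^'b^'b \<Rightarrow> 'a^'b^'b" where
  "mat_exp M = (\<Sum>k. (1 / fact k) *\<^sub>R ((\<lambda>X. M ** X) ^^ k) (mat 1))"

definition pos_definite :: "real^'b^'b \<Rightarrow> bool" where
  "pos_definite M \<longleftrightarrow> transpose M = M \<and> (\<forall>v. v \<noteq> 0 \<longrightarrow> v \<bullet> (M *v v) > 0)"

definition neg_definite :: "real^'b^'b \<Rightarrow> bool" where
  "neg_definite M \<longleftrightarrow> transpose M = M \<and> (\<forall>v. v \<noteq> 0 \<longrightarrow> v \<bullet> (M *v v) < 0)"

definition mat_eigenvalue :: "complex^'b^'b \<Rightarrow> complex \<Rightarrow> bool" where
  "mat_eigenvalue M z \<longleftrightarrow> (\<exists>v. v \<noteq> 0 \<and> M *v v = z *s v)"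

text \<open>\<open>J\<close> is a direct sum of Jordan blocks with nonzero eigenvalues. A finite index type carries no
  order, so the rows and columns are numbered by some bijection \<open>f\<close> with an initial segment of the
  naturals (the same one for both).\<close>

definition jordan_form_nonzero :: "complex^'k^'k \<Rightarrow> bool" where
  "jordan_form_nonzero J \<longleftrightarrow>
     (\<exists>n_as f. 0 \<notin> fst ` set n_as \<and> 0 \<notin> snd ` set n_as \<and>
        sum_list (map fst n_as) = CARD('k) \<and>
        bij_betw f {..<CARD('k)} (UNIV :: 'k set) \<and>
        (\<forall>i<CARD('k). \<forall>j<CARD('k). J $ f i $ f j = jordan_matrix n_as $$ (i, j)))"

section \<open>Controllability\<close>

definition controllable :: "real^'n^'n \<Rightarrow> real^'m^'n \<Rightarrow> bool" where
  "controllable A B \<longleftrightarrow>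
     (\<forall>x0 x1. \<exists>T>0. \<exists>u x. continuous_on {0..T} u \<and> x 0 = x0 \<and> x T = x1 \<and>
        (\<forall>t\<in>{0..T}. (x has_vector_derivative A *v x t + B *v u t) (at t within {0..T})))"

section \<open>Directed graphs on the agents\<close>

text \<open>A pair \<open>(i, j) \<in> G\<close> means that agent \<open>j\<close> receives information from agent \<open>i\<close>.\<close>

definition neighbors :: "('N \<times> 'N) set \<Rightarrow> 'N \<Rightarrow> 'N set" where
  "neighbors G j = {i. (i, j) \<in> G}"

definition has_directed_spanning_tree :: "('N \<times> 'N) set \<Rightarrow> bool" where
  "has_directed_spanning_tree G \<longleftrightarrow> (\<exists>r. \<forall>i. (r, i) \<in> G\<^sup>*)"

definition adjacency :: "('N::finite \<times> 'N) set \<Rightarrow> real^'N^'N" where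
  "adjacency G = (\<chi> i j. if (j, i) \<in> G then 1 else 0)"

definition degree_matrix :: "('N::finite \<times> 'N) set \<Rightarrow> real^'N^'N" where
  "degree_matrix G = (\<chi> i j. if i = j then (\<Sum>k\<in>neighbors G i. adjacency G $ i $ k) else 0)"

definition laplacian :: "('N::finite \<times> 'N) set \<Rightarrow> real^'N^'N" where
  "laplacian G = degree_matrix G - adjacency G"

section \<open>Transformed coordinates\<close>

text \<open>The \<open>N\<close> Jordan coordinates are indexed by \<open>'k option\<close> with \<open>CARD('k) = N - 1\<close>: \<open>None\<close> is the
  first coordinate, which belongs to the eigenvalue 0, and \<open>Some l\<close> are the coordinates \<open>2, \<dots>, N\<close>.
  The three matrices below are the block matrices with \<open>J\<close> and zeros \<open>[0 0; 0 J]\<close>, \<open>[0 J]\<close> and \<open>[0; J]\<close>.\<close>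

definition block_zero :: "complex^'k::finite^'k \<Rightarrow> complex^('k option)^('k option)" where
  "block_zero J = (\<chi> i j. case (i, j) of (Some p, Some q) \<Rightarrow> J $ p $ q | _ \<Rightarrow> 0)"

definition zero_left :: "complex^'k::finite^'k \<Rightarrow> complex^('k option)^'k" where
  "zero_left J = (\<chi> p j. case j of Some q \<Rightarrow> J $ p $ q | None \<Rightarrow> 0)"

definition zero_top :: "complex^'k::finite^'k \<Rightarrow> complex^'k^('k option)" where
  "zero_top J = (\<chi> i q. case i of Some p \<Rightarrow> J $ p $ q | None \<Rightarrow> 0)"

definition stack :: "('N::finite \<Rightarrow> real^'n) \<Rightarrow> complex^('N \<times> 'n)" where
  "stack v = (\<chi> p. complex_of_real (v (fst p) $ snd p))"

definition xhat :: "complex^('k::finite option)^'N::finite \<Rightarrow> ('N \<Rightarrow> real^'n::finite) \<Rightarrow> complex^('k option \<times> 'n)" where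
  "xhat S v = matrix_inv (kron S (mat 1 :: complex^'n^'n)) *v stack v"

definition xhat_tail :: "complex^('k::finite option)^'N::finite \<Rightarrow> ('N \<Rightarrow> real^'n::finite) \<Rightarrow> complex^('k \<times> 'n)" where
  "xhat_tail S v = (\<chi> p. xhat S v $ (Some (fst p), snd p))"

definition Delta_mat :: "complex^('k::finite option)^'N::finite \<Rightarrow> complex^'k^'k \<Rightarrow> complex^'N^'k" where
  "Delta_mat S J = zero_left J ** matrix_inv S"

definition Theta_mat :: "complex^('k::finite option)^'N::finite \<Rightarrow> complex^'k^'k \<Rightarrow> complex^'k^'N" where
  "Theta_mat S J = S ** zero_top J"

section \<open>Executions of the event-triggered model-based scheme\<close>

definition control_input ::
  "real \<Rightarrow> real^'n^'m \<Rightarrow> ('N::finite \<times> 'N) set \<Rightarrow> ('N \<Rightarrow> real \<Rightarrow> real^'n) \<Rightarrow> 'N \<Rightarrow> real \<Rightarrow> real^'m" where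
  "control_input c F G y i t = (c *\<^sub>R F) *v (\<Sum>j\<in>neighbors G i. y i t - y j t)"

definition consecutive_events :: "real set \<Rightarrow> real \<Rightarrow> real \<Rightarrow> bool" where
  "consecutive_events S s t \<longleftrightarrow> s \<in> S \<and> t \<in> S \<and> s < t \<and> S \<inter> {s<..<t} = {}"

text \<open>The solution of the model equation started at the event time \<open>s\<close> and never reset again.\<close>

definition unreset_model :: "real^'n^'n \<Rightarrow> real \<Rightarrow> real^'n \<Rightarrow> (real \<Rightarrow> real^'n) \<Rightarrow> bool" where
  "unreset_model A s v z \<longleftrightarrow>
     z s = v \<and> (\<forall>t\<ge>s. (z has_vector_derivative A *v z t) (at t within {s..}))"

definition first_hitting :: "(real \<Rightarrow> real) \<Rightarrow> (real \<Rightarrow> real) \<Rightarrow> real \<Rightarrow> real \<Rightarrow> bool" where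
  "first_hitting h thr s t \<longleftrightarrow> s < t \<and> h t = thr t \<and> (\<forall>r. s < r \<and> r < t \<longrightarrow> h r \<noteq> thr r)"

text \<open>An execution lives on \<open>[0, T)\<close> with \<open>0 < T \<le> \<infinity>\<close>; \<open>ev i\<close> is the set of event times of agent \<open>i\<close>.
  Event times are generated one after the other, so only finitely many lie in \<open>[0, s]\<close> for each
  \<open>s < T\<close>. They may still accumulate at a finite \<open>T\<close>, beyond which such a Zeno execution cannot be
  continued: Zeno behavior is not excluded by this definition. At an event time the value \<open>y i t\<close>
  is the one after the reset; the trigger looks at the model \<open>z\<close> that has not been reset.\<close>

definition execution ::
  "real^'n^'n \<Rightarrow> real^'m^'n \<Rightarrow> real^'n^'m \<Rightarrow> real \<Rightarrow> ('N::finite \<times> 'N) set \<Rightarrow> (real \<Rightarrow> real) \<Rightarrow> ereal \<Rightarrow>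
   ('N \<Rightarrow> real \<Rightarrow> real^'n) \<Rightarrow> ('N \<Rightarrow> real \<Rightarrow> real^'n) \<Rightarrow> ('N \<Rightarrow> real set) \<Rightarrow> bool" where
  "execution A B F c G thr T x y ev \<longleftrightarrow>
     0 < T \<and>
     (\<forall>i. 0 \<in> ev i \<and> ev i \<subseteq> {t. 0 \<le> t \<and> ereal t < T}) \<and>
     (\<forall>i s. ereal s < T \<longrightarrow> finite (ev i \<inter> {..s})) \<and>
     (\<forall>i. continuous_on {t. 0 \<le> t \<and> ereal t < T} (x i)) \<and>
     (\<forall>i t. 0 \<le> t \<and> ereal t < T \<and> (\<forall>j. t \<notin> ev j) \<longrightarrow>
        (x i has_vector_derivative A *v x i t + B *v control_input c F G y i t) (at t)) \<and>
     (\<forall>i. \<forall>s\<in>ev i. \<exists>z. unreset_model A s (x i s) z \<and>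
        (\<forall>t\<ge>s. ereal t < T \<and> ev i \<inter> {s<..t} = {} \<longrightarrow> y i t = z t) \<and>
        (\<forall>t>s. ereal t < T \<longrightarrow>
           (consecutive_events (ev i) s t \<longleftrightarrow> first_hitting (\<lambda>r. norm (z r - x i r)) thr s t)))"

definition maximal_execution ::
  "real^'n^'n \<Rightarrow> real^'m^'n \<Rightarrow> real^'n^'m \<Rightarrow> real \<Rightarrow> ('N::finite \<times> 'N) set \<Rightarrow> (real \<Rightarrow> real) \<Rightarrow> ereal \<Rightarrow>
   ('N \<Rightarrow> real \<Rightarrow> real^'n) \<Rightarrow> ('N \<Rightarrow> real \<Rightarrow> real^'n) \<Rightarrow> ('N \<Rightarrow> real set) \<Rightarrow> bool" where
  "maximal_execution A B F c G thr T x y ev \<longleftrightarrow>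
     execution A B F c G thr T x y ev \<and>
     \<not> (\<exists>T' x' y' ev'. T < T' \<and> execution A B F c G thr T' x' y' ev' \<and>
          (\<forall>i t. 0 \<le> t \<and> ereal t < T \<longrightarrow>
             x' i t = x i t \<and> y' i t = y i t \<and> (t \<in> ev' i \<longleftrightarrow> t \<in> ev i)))"

definition zeno :: "('N \<Rightarrow> real set) \<Rightarrow> bool" where
  "zeno ev \<longleftrightarrow> (\<exists>i a b. infinite (ev i \<inter> {a..b}))"

end

theory Submission
  imports Defs
begin

text \<open>
  In the coordinates that put the Laplacian into Jordan form, the first one (eigenvalue \<open>0\<close>) is the
  agents' common motion, and the others, the tail, measure their disagreement. The tail satisfies
  a closed linear equation with the matrix \<open>Ahat\<close>, forced by the local errors alone
  (\<open>tail_has_vector_derivative\<close>). The trigger keeps each local error below the threshold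
  (\<open>error_le_threshold\<close>): the error of the model restarts at \<open>0\<close> after an event, and it cannot pass
  the threshold without causing the next event. Since \<open>Ahat\<close> decays at the rate \<open>lamh\<close>, faster than the
  threshold, variation of constants shows that the tail decays like the threshold
  (\<open>norm_tail_le\<close>). The column of \<open>S\<^sub>L\<close> for the eigenvalue \<open>0\<close> is in the kernel of the Laplacian,
  which by the spanning tree consists of constant vectors; therefore differences of agents depend on the tail
  only, and tend to \<open>0\<close> (\<open>consensus\<close>).

  The same bound on the tail controls the inputs: the disagreement of the models is at most
  \<open>K1 * exp (- lamh * t) + K2 * exp (- lam * t)\<close> (\<open>norm_disagreement_le\<close>). Between two consecutive events
  the error of an agent has to grow from \<open>0\<close> to the threshold, driven by its input and amplified at most
  at the rate \<open>mat_norm A\<close>. Comparison gives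
  \<open>\<beta> \<le> K3 s * (exp ((mat_norm A + lamh) * (t - s)) - 1)\<close> (\<open>threshold_le_gap\<close>), which is the lower bound
  \<open>\<tau> s\<close> for \<open>t - s\<close> and also forces \<open>K3 s > 0\<close>. The delicate point is that \<open>K1\<close> may be negative
  (\<open>event_gap_estimate\<close>).

  All of this holds on whatever interval \<open>[0, T)\<close> the execution lives. It remains to exclude a finite
  \<open>T\<close>. The gaps are bounded below uniformly in \<open>s\<close> (\<open>uniform_event_gap\<close>), so before a finite \<open>T\<close>
  there are only finitely many events. After the last of them the execution follows a linear system,
  which can be continued through \<open>T\<close>, with resets at \<open>T\<close> for the agents that hit the threshold
  there (\<open>extendable_beyond_finite_horizon\<close>). This contradicts maximality. With \<open>T = \<infinity>\<close>, events
  are finitely many in every bounded interval by the definition of an execution.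
\<close>

section \<open>Linear flows\<close>

text \<open>The solution operator of the autonomous linear equation \<open>v' = L v\<close>. It is defined for operators on any
Euclidean space, so that one theory serves the real agent dynamics, the complex transformed dynamics
and the joint system of states and models on a product space.\<close>

definition flow :: "('a::euclidean_space \<Rightarrow> 'a) \<Rightarrow> real \<Rightarrow> 'a \<Rightarrow> 'a" where
  "flow L t v = (\<Sum>k. (t ^ k / fact k) *\<^sub>R (L ^^ k) v)"

lemma norm_funpow_le:
  fixes L :: "'a::real_normed_vector \<Rightarrow> 'a"
  assumes "bounded_linear L"
  shows "norm ((L ^^ k) v) \<le> onorm L ^ k * norm v"
proof (induction k)
  case (Suc k)
  have "norm (L ((L ^^ k) v)) \<le> onorm L * norm ((L ^^ k) v)"
    by (rule onorm[OF assms])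
  also have "\<dots> \<le> onorm L * (onorm L ^ k * norm v)"
    by (rule mult_left_mono[OF Suc onorm_pos_le[OF assms]])
  finally show ?case by (simp add: mult.assoc)
qed simp

lemma norm_flow_term_le:
  fixes L :: "'a::real_normed_vector \<Rightarrow> 'a"
  assumes "bounded_linear L"
  shows "norm ((t ^ k / fact k) *\<^sub>R (L ^^ k) v) \<le> (onorm L * \<bar>t\<bar>) ^ k /\<^sub>R fact k * norm v"
  using mult_left_mono[OF norm_funpow_le[OF assms, of k v], of "\<bar>t\<bar> ^ k / fact k"]
  by (simp add: power_mult_distrib power_abs field_simps)

lemma summable_norm_flow:
  fixes L :: "'a::euclidean_space \<Rightarrow> 'a"
  assumes "bounded_linear L"
  shows "summable (\<lambda>k. norm ((t ^ k / fact k) *\<^sub>R (L ^^ k) v))"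
  by (rule summable_comparison_test'[OF summable_mult2[OF summable_exp_generic]])
     (use norm_flow_term_le[OF assms] in auto)

lemmas summable_flow = summable_norm_flow[THEN summable_norm_cancel]

lemma norm_flow_le:
  assumes "bounded_linear L" "t \<ge> 0"
  shows "norm (flow L t v) \<le> exp (onorm L * t) * norm v"
proof -
  have s: "(\<lambda>k. (onorm L * \<bar>t\<bar>) ^ k /\<^sub>R fact k * norm v) sums (exp (onorm L * \<bar>t\<bar>) * norm v)"
    by (intro sums_mult2 exp_converges)
  have "norm (flow L t v) \<le> (\<Sum>k. norm ((t ^ k / fact k) *\<^sub>R (L ^^ k) v))"
    unfolding flow_def by (rule summable_norm[OF summable_norm_flow[OF assms(1)]])
  also have "\<dots> \<le> (\<Sum>k. (onorm L * \<bar>t\<bar>) ^ k /\<^sub>R fact k * norm v)"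
    by (intro suminf_le norm_flow_term_le summable_norm_flow sums_summable[OF s] assms(1))
  also have "\<dots> = exp (onorm L * \<bar>t\<bar>) * norm v"
    using s by (rule sums_unique[symmetric])
  finally show ?thesis using assms(2) by simp
qed

lemma flow_0 [simp]: "flow L 0 v = v"
proof -
  have "flow L 0 v = (\<Sum>k\<in>{0}. ((0::real) ^ k / fact k) *\<^sub>R (L ^^ k) v)"
    unfolding flow_def by (intro suminf_finite) auto
  then show ?thesis by simp
qed

lemma bounded_linear_flow:
  assumes "bounded_linear L"
  shows "bounded_linear (flow L t)"
proof -
  interpret bounded_linear L by fact
  have lin: "linear (L ^^ k)" for k
    by (induction k) (auto simp: linear_iff add scaleR)
  have "linear (flow L t)"
  proof (rule linearI)
    fix v w r
    have "flow L t (v + w) = (\<Sum>k. (t ^ k / fact k) *\<^sub>R (L ^^ k) v + (t ^ k / fact k) *\<^sub>R (L ^^ k) w)"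
      by (simp add: flow_def linear_add[OF lin] scaleR_add_right)
    then show "flow L t (v + w) = flow L t v + flow L t w"
      by (simp add: flow_def suminf_add[OF summable_flow[OF assms] summable_flow[OF assms]])
    have "flow L t (r *\<^sub>R v) = (\<Sum>k. r *\<^sub>R ((t ^ k / fact k) *\<^sub>R (L ^^ k) v))"
      by (simp add: flow_def linear_scale[OF lin] mult.commute)
    then show "flow L t (r *\<^sub>R v) = r *\<^sub>R flow L t v"
      by (simp add: flow_def suminf_scaleR_right[OF summable_flow[OF assms]])
  qed
  then show ?thesis by (simp add: linear_conv_bounded_linear)
qed

text \<open>Expanding the argument in a basis reduces continuity and differentiability of the flow along a moving
argument to those of finitely many fixed trajectories.\<close>

lemma flow_basis_sum:
  assumes "bounded_linear L"
  shows "flow L t v = (\<Sum>b\<in>Basis. (v \<bullet> b) *\<^sub>R flow L t b)"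
proof -
  note lin = bounded_linear.linear[OF bounded_linear_flow[OF assms]]
  have "flow L t v = flow L t (\<Sum>b\<in>Basis. (v \<bullet> b) *\<^sub>R b)" by (simp add: euclidean_representation)
  then show ?thesis by (simp add: linear_sum[OF lin] linear_scale[OF lin])
qed

lemma flow_commute:
  assumes "bounded_linear L"
  shows "L (flow L t v) = flow L t (L v)"
proof -
  interpret bounded_linear L by fact
  show ?thesis
    unfolding flow_def
    by (simp add: suminf[OF summable_flow[OF assms]] scaleR funpow_swap1)
qed

text \<open>Each coordinate of \<open>flow L t v\<close> is a real power series in \<open>t\<close> that converges everywhere, so
  the flow may be differentiated term by term.\<close>

lemma flow_has_vector_derivative:
  assumes "bounded_linear L"
  shows "((\<lambda>t. flow L t v) has_vector_derivative flow L t (L v)) (at t within X)"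
proof -
  have inner: "flow L t w \<bullet> b = (\<Sum>k. ((L ^^ k) w \<bullet> b) / fact k * t ^ k)" for t w b
    unfolding flow_def
    by (simp add: bounded_linear.suminf[OF bounded_linear_inner_left summable_flow[OF assms]]
        mult.commute)
  have "((\<lambda>t. flow L t v \<bullet> b) has_derivative (\<lambda>h. (h *\<^sub>R flow L t (L v)) \<bullet> b)) (at t within X)" for b
  proof -
    let ?c = "\<lambda>k. ((L ^^ k) v \<bullet> b) / fact k"
    have s: "summable (\<lambda>k. ?c k * y ^ k)" for y
      using bounded_linear.summable[OF bounded_linear_inner_left summable_flow[OF assms, of y v], of b]
      by (simp add: mult.commute)
    have "((\<lambda>t. \<Sum>k. ?c k * t ^ k) has_field_derivative (\<Sum>k. diffs ?c k * t ^ k)) (at t)"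
      by (rule termdiffs_strong_converges_everywhere[OF s])
    moreover have "diffs ?c k = ((L ^^ k) (L v) \<bullet> b) / fact k" for k
      by (simp add: diffs_def funpow_swap1 del: of_nat_Suc)
    ultimately have "((\<lambda>t. flow L t v \<bullet> b) has_field_derivative (flow L t (L v) \<bullet> b)) (at t)"
      by (simp add: inner)
    then have "((\<lambda>t. flow L t v \<bullet> b) has_field_derivative (flow L t (L v) \<bullet> b)) (at t within X)"
      by (rule has_field_derivative_at_within)
    then show ?thesis
      by (simp add: has_field_derivative_def mult.commute[of _ "flow L t (L v) \<bullet> b"])
  qed
  then show ?thesis
    unfolding has_vector_derivative_def by (subst has_derivative_componentwise_within) blast
qed

lemma flow_solves:
  assumes "bounded_linear L"
  shows "((\<lambda>t. flow L (t - s) v) has_vector_derivative L (flow L (t - s) v)) (at t within X)"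
proof -
  have "((\<lambda>t. t - s) has_vector_derivative 1) (at t within X)"
    by (auto intro!: derivative_eq_intros)
  from vector_diff_chain_within[OF this flow_has_vector_derivative[OF assms], of v]
  show ?thesis by (simp add: o_def flow_commute[OF assms])
qed

text \<open>Transporting a curve back along the flow removes the linear part of its derivative; this is
  the variation of constants formula in differential form.\<close>

lemma flow_transport_has_vector_derivative:
  fixes f :: "real \<Rightarrow> 'a::euclidean_space"
  assumes "bounded_linear L" and f: "(f has_vector_derivative f') (at r within X)"
  shows "((\<lambda>r. flow L (t - r) (f r)) has_vector_derivative flow L (t - r) (f' - L (f r))) (at r within X)"
proof -
  note lin = bounded_linear.linear[OF bounded_linear_flow[OF assms(1)]]
  note linL = bounded_linear.linear[OF assms(1)]
  note exp = flow_basis_sum[OF assms(1)]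
  have d: "((\<lambda>r. flow L (t - r) b) has_vector_derivative - flow L (t - r) (L b)) (at r within X)" for b
  proof -
    have "((\<lambda>r. t - r) has_vector_derivative -1) (at r within X)"
      by (auto intro!: derivative_eq_intros)
    from vector_diff_chain_within[OF this flow_has_vector_derivative[OF assms(1)], of b]
    show ?thesis by (simp add: o_def)
  qed
  have fb: "((\<lambda>r. f r \<bullet> b) has_field_derivative (f' \<bullet> b)) (at r within X)" for b
    using bounded_linear.has_vector_derivative[OF bounded_linear_inner_left f]
    by (simp add: has_real_derivative_iff_has_vector_derivative)
  have "((\<lambda>r. \<Sum>b\<in>Basis. (f r \<bullet> b) *\<^sub>R flow L (t - r) b) has_vector_derivative
         (\<Sum>b\<in>Basis. (f r \<bullet> b) *\<^sub>R (- flow L (t - r) (L b)) + (f' \<bullet> b) *\<^sub>R flow L (t - r) b)) (at r within X)"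
    by (intro has_vector_derivative_sum has_vector_derivative_scaleR fb d)
  moreover have "(\<Sum>b\<in>Basis. (f r \<bullet> b) *\<^sub>R (- flow L (t - r) (L b)) + (f' \<bullet> b) *\<^sub>R flow L (t - r) b)
      = flow L (t - r) (f' - L (f r))"
  proof -
    have "(\<Sum>b\<in>Basis. (f r \<bullet> b) *\<^sub>R flow L (t - r) (L b)) = flow L (t - r) (L (f r))"
      using exp[of "t - r" "f r"] flow_commute[OF assms(1)]
      by (simp flip: flow_commute[OF assms(1)] add: linear_sum[OF linL] linear_scale[OF linL])
    then show ?thesis
      using exp[of "t - r" f'] by (simp add: sum_subtractf linear_diff[OF lin])
  qed
  ultimately show ?thesis by (simp flip: exp)
qed

section \<open>Perturbed linear systems\<close>

text \<open>The mean value inequality, with finitely many points at which nothing is known about the derivatives: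
these are the event times, where the inputs jump.\<close>

lemma norm_increment_le:
  fixes f :: "real \<Rightarrow> 'a::banach"
  assumes "finite E" "a \<le> b" "continuous_on {a..b} f" "continuous_on {a..b} g"
    and f: "\<And>r. r \<in> {a<..<b} - E \<Longrightarrow> (f has_vector_derivative f' r) (at r)"
    and g: "\<And>r. r \<in> {a<..<b} - E \<Longrightarrow> (g has_real_derivative g' r) (at r)"
    and le: "\<And>r. r \<in> {a<..<b} - E \<Longrightarrow> norm (f' r) \<le> g' r"
  shows "norm (f b - f a) \<le> g b - g a"
proof -
  let ?E = "insert a (insert b E)"
  define p where "p r = (if r \<in> {a<..<b} - E then f' r else 0)" for r
  define q where "q r = (if r \<in> {a<..<b} - E then g' r else 0)" for r
  have p: "(p has_integral (f b - f a)) {a..b}"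
    by (rule fundamental_theorem_of_calculus_interior_strong[OF assms(1,2) _ assms(3)])
       (use f in \<open>auto simp: p_def\<close>)
  have q: "(q has_integral (g b - g a)) {a..b}"
    by (rule fundamental_theorem_of_calculus_interior_strong[OF assms(1,2) _ assms(4)])
       (use g in \<open>auto simp: q_def has_real_derivative_iff_has_vector_derivative\<close>)
  have "norm (integral {a..b} p) \<le> integral {a..b} q"
    by (rule integral_norm_bound_integral) (use p q le in \<open>auto simp: p_def q_def\<close>)
  then show ?thesis using p q by (simp add: integral_unique)
qed

text \<open>In the variation of constants formula the integrand at time \<open>r\<close> is the forcing transported by the flow
over the time \<open>t - r\<close>. Instead of an integral, the bound uses any antiderivative \<open>g\<close> of a majorant of that
integrand.\<close>

lemma variation_of_constants_bound:
  fixes f :: "real \<Rightarrow> 'a::euclidean_space"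
  assumes L: "bounded_linear L"
    and fl: "\<And>u v. u \<ge> 0 \<Longrightarrow> norm (flow L u v) \<le> b * exp (\<kappa> * u) * norm v"
    and "finite E" "s \<le> t" and cf: "continuous_on {s..t} f"
    and f: "\<And>r. r \<in> {s<..<t} - E \<Longrightarrow> (f has_vector_derivative L (f r) + w r) (at r)"
    and g: "\<And>r. r \<in> {s..t} \<Longrightarrow> (g has_real_derivative b * exp (\<kappa> * (t - r)) * W r) (at r)"
    and w: "\<And>r. r \<in> {s<..<t} - E \<Longrightarrow> norm (w r) \<le> W r"
  shows "norm (f t - flow L (t - s) (f s)) \<le> g t - g s"
proof -
  have b: "0 \<le> b"
  proof -
    obtain e :: 'a where "e \<in> Basis" using nonempty_Basis by blast
    with fl[of 0 e] show ?thesis by simp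
  qed
  have "norm (flow L (t - t) (f t) - flow L (t - s) (f s)) \<le> g t - g s"
  proof (rule norm_increment_le[OF assms(3,4)])
    have "continuous_on {s..t} (\<lambda>r. flow L (t - r) e)" for e
      by (rule continuous_on_vector_derivative,
          rule flow_transport_has_vector_derivative[OF L has_vector_derivative_const])
    then show "continuous_on {s..t} (\<lambda>r. flow L (t - r) (f r))"
      by (subst flow_basis_sum[OF L]) (intro continuous_intros cf)
    show "continuous_on {s..t} g"
      by (rule DERIV_continuous_on[OF has_field_derivative_at_within[OF g]])
  next
    fix r assume r: "r \<in> {s<..<t} - E"
    show "((\<lambda>r. flow L (t - r) (f r)) has_vector_derivative flow L (t - r) (w r)) (at r)"
      using flow_transport_has_vector_derivative[OF L f[OF r]] by simp
    show "(g has_real_derivative b * exp (\<kappa> * (t - r)) * W r) (at r)"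
      using r by (intro g) auto
    have "norm (flow L (t - r) (w r)) \<le> b * exp (\<kappa> * (t - r)) * norm (w r)"
      using r by (intro fl) auto
    also have "\<dots> \<le> b * exp (\<kappa> * (t - r)) * W r"
      using b w[OF r] by (intro mult_left_mono) auto
    finally show "norm (flow L (t - r) (w r)) \<le> b * exp (\<kappa> * (t - r)) * W r" .
  qed
  then show ?thesis by simp
qed

lemma linear_solution_eq_flow:
  fixes f :: "real \<Rightarrow> 'a::euclidean_space"
  assumes L: "bounded_linear L" and "finite E" "s \<le> t" "continuous_on {s..t} f"
    and "\<And>r. r \<in> {s<..<t} - E \<Longrightarrow> (f has_vector_derivative L (f r)) (at r)"
  shows "f t = flow L (t - s) (f s)"
proof -
  have "norm (f t - flow L (t - s) (f s)) \<le> 0 - 0"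
    by (rule variation_of_constants_bound[where b = 1 and \<kappa> = "onorm L" and w = "\<lambda>_. 0" and W = "\<lambda>_. 0"
          and g = "\<lambda>_. 0" and E = E])
       (use assms norm_flow_le[OF L] in auto)
  then show ?thesis by simp
qed

section \<open>Matrix norms, matrix exponentials and Kronecker products\<close>

lemma norm_matrix_vector_le:
  fixes M :: "('a::{real_normed_field,euclidean_space})^'c^'b"
  shows "norm (M *v v) \<le> mat_norm M * norm v"
  unfolding mat_norm_def by (rule onorm) simp

lemma mat_norm_nonneg:
  fixes M :: "('a::{real_normed_field,euclidean_space})^'c^'b"
  shows "0 \<le> mat_norm M"
  unfolding mat_norm_def by (rule onorm_pos_le) simp

lemma bounded_linear_matrix_left:
  fixes M :: "('a::{real_normed_field,euclidean_space})^'b^'b"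
  shows "bounded_linear (\<lambda>X :: 'a^'b^'b. M ** X)"
proof -
  have "linear (\<lambda>X :: 'a^'b^'b. M ** X)"
    by (rule linearI)
       (simp_all add: Finite_Cartesian_Product.vec_eq_iff matrix_matrix_mult_def algebra_simps sum.distrib scaleR_sum_right)
  then show ?thesis by (simp add: linear_conv_bounded_linear)
qed

lemma bounded_linear_matrix_apply:
  fixes v :: "('a::{real_normed_field,euclidean_space})^'c"
  shows "bounded_linear (\<lambda>X :: 'a^'c^'b. X *v v)"
proof -
  have "linear (\<lambda>X :: 'a^'c^'b. X *v v)"
    by (rule linearI)
       (simp_all add: Finite_Cartesian_Product.vec_eq_iff matrix_vector_mult_def algebra_simps sum.distrib scaleR_sum_right)
  then show ?thesis by (simp add: linear_conv_bounded_linear)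
qed

lemma scaleR_matrix_vector:
  fixes M :: "('a::{real_normed_field,euclidean_space})^'c^'b"
  shows "(r *\<^sub>R M) *v v = r *\<^sub>R (M *v v)"
  by (rule linear_scale[OF bounded_linear.linear[OF bounded_linear_matrix_apply]])

lemma funpow_matrix_mult_vector:
  fixes M :: "'a::comm_semiring_1^'b^'b"
  shows "((\<lambda>X. M ** X) ^^ k) (mat 1) *v v = ((*v) M ^^ k) v"
proof (induction k)
  case (Suc k)
  then show ?case by (simp flip: matrix_vector_mul_assoc)
qed simp

text \<open>The link between the exponential series of matrices, in which the decay hypothesis is stated, and the
flow.\<close>

lemma mat_exp_mult_vector:
  fixes M :: "('a::{real_normed_field,euclidean_space})^'b^'b"
  shows "mat_exp (t *\<^sub>R M) *v v = flow ((*v) M) t v"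
proof -
  let ?N = "t *\<^sub>R M"
  have pow: "((*v) ?N ^^ k) v = t ^ k *\<^sub>R ((*v) M ^^ k) v" for k
    by (induction k) (simp_all add: scaleR_matrix_vector linear_scale[OF matrix_vector_mul_linear] mult.commute)
  have s: "summable (\<lambda>k. (1 / fact k :: real) *\<^sub>R ((\<lambda>X. ?N ** X) ^^ k) (mat 1))"
    using summable_flow[OF bounded_linear_matrix_left, of 1 ?N "mat 1"] by simp
  have "mat_exp ?N *v v = (\<Sum>k. (1 / fact k :: real) *\<^sub>R (((\<lambda>X. ?N ** X) ^^ k) (mat 1) *v v))"
    unfolding mat_exp_def
    by (subst bounded_linear.suminf[OF bounded_linear_matrix_apply s]) (simp only: scaleR_matrix_vector)
  also have "\<dots> = flow ((*v) M) t v"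
    by (simp add: flow_def funpow_matrix_mult_vector pow)
  finally show ?thesis .
qed

lemma kron_vector_nth:
  "(kron M M' *v w) $ (i, q) = (\<Sum>k\<in>UNIV. \<Sum>r\<in>UNIV. M $ i $ k * M' $ q $ r * w $ (k, r))"
  by (simp add: matrix_vector_mult_def kron_def sum.cartesian_product case_prod_beta
      flip: UNIV_Times_UNIV)

lemma kron_id_vector_nth:
  fixes M :: "('a::comm_ring_1)^'c^'b"
  shows "(kron M (mat 1) *v w) $ (i, q) = (\<Sum>k\<in>UNIV. M $ i $ k * w $ (k, q))"
proof -
  have "(\<Sum>r\<in>UNIV. M $ i $ k * (mat 1 :: 'a^'d^'d) $ q $ r * w $ (k, r)) = M $ i $ k * w $ (k, q)" for k
    by (simp add: Finite_Cartesian_Product.mat_def if_distrib[of "\<lambda>x. _ * x * _"] cong: if_cong)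
  then show ?thesis by (simp add: kron_vector_nth)
qed

lemma kron_mult:
  fixes M :: "('a::comm_ring_1)^'c^'b"
  shows "kron M M' ** kron R R' = kron (M ** R) (M' ** R')"
  by (simp add: Finite_Cartesian_Product.vec_eq_iff matrix_matrix_mult_def kron_def sum_product sum.cartesian_product
      case_prod_beta mult_ac flip: UNIV_Times_UNIV)

lemma kron_mat_1: "kron (mat 1 :: 'a::comm_ring_1^'b^'b) (mat 1 :: 'a^'c^'c) = mat 1"
  by (auto simp: Finite_Cartesian_Product.vec_eq_iff kron_def Finite_Cartesian_Product.mat_def)

lemma invertible_matrix_inv:
  assumes "invertible S"
  shows "S ** matrix_inv S = mat 1" "matrix_inv S ** S = mat 1"
  using someI_ex[OF assms[unfolded invertible_def]] by (simp_all add: matrix_inv_def)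

lemma matrix_inv_kron_id:
  fixes S :: "('a::comm_ring_1)^'c^'b"
  assumes "invertible S"
  shows "matrix_inv (kron S (mat 1 :: 'a^'d^'d)) = kron (matrix_inv S) (mat 1)" (is "matrix_inv ?K = ?R")
proof -
  have R: "?K ** ?R = mat 1" "?R ** ?K = mat 1"
    by (simp_all add: kron_mult invertible_matrix_inv[OF assms] kron_mat_1)
  then have "invertible ?K" unfolding invertible_def by blast
  from invertible_matrix_inv[OF this] have "?R = ?R ** (?K ** matrix_inv ?K)" by simp
  also have "\<dots> = matrix_inv ?K" by (simp add: matrix_mul_assoc R)
  finally show ?thesis ..
qed

text \<open>The action of \<open>kron M (mat 1)\<close> is that of \<open>M\<close> on each column \<open>q\<close> of the block vector separately, and
squared norms add up over the columns.\<close>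

lemma norm_kron_id_le:
  fixes M :: "('a::{real_normed_field,euclidean_space})^'c^'b" and w :: "'a^('c \<times> 'd::finite)"
  shows "norm (kron M (mat 1) *v w) \<le> mat_norm M * norm w"
proof -
  define col where "col q = (\<chi> k. w $ (k, q))" for q
  have sq: "(norm z)\<^sup>2 = (\<Sum>q\<in>UNIV. \<Sum>k\<in>UNIV. (norm (z $ (k, q)))\<^sup>2)" for z :: "'a^('e::finite \<times> 'd)"
  proof -
    have "(norm z)\<^sup>2 = (\<Sum>p\<in>UNIV. (norm (z $ p))\<^sup>2)"
      by (simp add: norm_vec_def L2_set_def sum_nonneg)
    also have "\<dots> = (\<Sum>k\<in>UNIV. \<Sum>q\<in>UNIV. (norm (z $ (k, q)))\<^sup>2)"
      by (simp add: sum.cartesian_product case_prod_beta flip: UNIV_Times_UNIV)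
    finally show ?thesis by (simp add: sum.swap[of _ _ "UNIV :: 'd set"])
  qed
  have sq1: "(norm z)\<^sup>2 = (\<Sum>k\<in>UNIV. (norm (z $ k))\<^sup>2)" for z :: "'a^'e::finite"
    by (simp add: norm_vec_def L2_set_def sum_nonneg)
  have entry: "(kron M (mat 1) *v w) $ (i, q) = (M *v col q) $ i" for i q
    by (simp add: kron_id_vector_nth col_def matrix_vector_mult_def[of M])
  have "(norm (kron M (mat 1) *v w))\<^sup>2 = (\<Sum>q\<in>UNIV. (norm (M *v col q))\<^sup>2)"
    by (simp only: sq sq1 entry)
  also have "\<dots> \<le> (\<Sum>q\<in>UNIV. (mat_norm M * norm (col q))\<^sup>2)"
    by (intro sum_mono power_mono norm_matrix_vector_le norm_ge_zero)
  also have "\<dots> = (mat_norm M)\<^sup>2 * (\<Sum>q\<in>UNIV. (norm (col q))\<^sup>2)"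
    by (simp add: power_mult_distrib sum_distrib_left)
  also have "\<dots> = (mat_norm M * norm w)\<^sup>2"
    unfolding sq power_mult_distrib by (simp only: sq1 col_def vec_lambda_beta)
  finally show ?thesis
    by (rule power2_le_imp_le) (simp add: mat_norm_nonneg)
qed

lemma norm_block_le:
  fixes z :: "('a::real_normed_vector)^('b::finite \<times> 'c::finite)"
  shows "norm (\<chi> q. z $ (i, q)) \<le> norm z"
proof -
  have "(\<Sum>q\<in>UNIV. (norm (z $ (i, q)))\<^sup>2) = (\<Sum>p\<in>{i} \<times> UNIV. (norm (z $ p))\<^sup>2)"
    by (subst sum.cartesian_product') simp
  also have "\<dots> \<le> (\<Sum>p\<in>UNIV. (norm (z $ p))\<^sup>2)"
    by (rule sum_mono2) auto
  finally show ?thesis by (simp add: norm_vec_def L2_set_def)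
qed

lemma bounded_linear_axis:
  "bounded_linear (\<lambda>x :: 'a::euclidean_space. axis i x :: 'a^'b)"
proof -
  have "linear (\<lambda>x :: 'a. axis i x :: 'a^'b)"
    by (rule linearI) (simp_all add: Finite_Cartesian_Product.vec_eq_iff axis_def)
  then show ?thesis by (simp add: linear_conv_bounded_linear)
qed

lemma has_vector_derivative_vec_lambda:
  fixes f :: "'b::finite \<Rightarrow> real \<Rightarrow> 'a::euclidean_space"
  assumes "\<And>i. (f i has_vector_derivative f' i) (at t within X)"
  shows "((\<lambda>t. \<chi> i. f i t) has_vector_derivative (\<chi> i. f' i)) (at t within X)"
proof -
  have *: "(\<chi> i. g i) = (\<Sum>i\<in>UNIV. axis i (g i))" for g :: "'b \<Rightarrow> 'a"
    by (simp add: Finite_Cartesian_Product.vec_eq_iff axis_def)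
  show ?thesis
    unfolding * by (intro has_vector_derivative_sum
        bounded_linear.has_vector_derivative[OF bounded_linear_axis] assms)
qed

lemma linear_stack: "linear (\<lambda>V :: real^'n^'N. stack (\<lambda>i. V $ i))"
  by (rule linearI) (simp_all add: Finite_Cartesian_Product.vec_eq_iff stack_def scaleR_conv_of_real[where 'a = complex])

lemma stack_has_vector_derivative:
  fixes v :: "'N::finite \<Rightarrow> real \<Rightarrow> real^'n"
  assumes "\<And>i. (v i has_vector_derivative v' i) (at t within X)"
  shows "((\<lambda>t. stack (\<lambda>i. v i t)) has_vector_derivative stack v') (at t within X)"
proof -
  have eta: "($) (\<chi> i. w i) = w" for w :: "'N \<Rightarrow> real^'n" by (rule ext) simp
  show ?thesis
    using bounded_linear.has_vector_derivative[OF linear_stack[unfolded linear_conv_bounded_linear]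
      has_vector_derivative_vec_lambda[of v, OF assms]]
    by (simp only: eta)
qed

lemma continuous_on_stack:
  fixes v :: "'N::finite \<Rightarrow> 'a::topological_space \<Rightarrow> real^'n"
  assumes "\<And>i. continuous_on X (v i)"
  shows "continuous_on X (\<lambda>t. stack (\<lambda>i. v i t))"
  unfolding stack_def
  by (intro continuous_on_vec_lambda continuous_intros assms)

lemma stack_add: "stack (\<lambda>i. v i + w i) = stack v + stack w"
  by (simp add: Finite_Cartesian_Product.vec_eq_iff stack_def)

lemma norm_stack_le:
  fixes v :: "'N::finite \<Rightarrow> real^'n"
  assumes "\<And>i. norm (v i) \<le> r"
  shows "norm (stack v) \<le> sqrt (real CARD('N)) * r"
proof -
  have r: "0 \<le> r" using norm_ge_zero assms by (rule order_trans)
  have "(norm (stack v))\<^sup>2 = (\<Sum>i\<in>UNIV. \<Sum>q\<in>UNIV. (v i $ q)\<^sup>2)"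
    by (simp add: norm_vec_def L2_set_def sum_nonneg stack_def sum.cartesian_product case_prod_beta
        flip: UNIV_Times_UNIV)
  also have "\<dots> = (\<Sum>i\<in>UNIV. (norm (v i))\<^sup>2)"
    by (simp add: norm_vec_def L2_set_def sum_nonneg)
  also have "\<dots> \<le> (\<Sum>i::'N\<in>UNIV. r\<^sup>2)"
    by (intro sum_mono power_mono assms norm_ge_zero)
  also have "\<dots> = (sqrt (real CARD('N)) * r)\<^sup>2"
    by (simp add: power_mult_distrib)
  finally show ?thesis by (rule power2_le_imp_le) (use r in simp)
qed

lemma kron_stack:
  fixes M :: "real^'N^'K" and K :: "real^'n^'m"
  shows "kron (cmat M) (cmat K) *v stack v = stack (\<lambda>i. \<Sum>j\<in>UNIV. M $ i $ j *\<^sub>R (K *v v j))"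
  unfolding Finite_Cartesian_Product.vec_eq_iff split_paired_All kron_vector_nth
  by (simp add: stack_def cmat_def matrix_vector_mult_def sum_distrib_left mult_ac)

lemma cmat_mat_1: "cmat (mat 1) = mat 1"
  by (simp add: Finite_Cartesian_Product.vec_eq_iff cmat_def Finite_Cartesian_Product.mat_def)

section \<open>Executions and their local errors\<close>

text \<open>The set of times at which \<open>h\<close> meets the threshold is compact, and nonempty by the intermediate value
theorem; its least element is the first hitting time.\<close>

lemma first_hitting_exists:
  assumes st: "s \<le> t" and h: "continuous_on {s..t} h" and thr: "continuous_on {s..t} thr"
    and "h s < thr s" "thr t \<le> h t"
  obtains r where "r \<le> t" "first_hitting h thr s r"
proof -
  let ?K = "{r \<in> {s..t}. h r = thr r}"
  have cont: "continuous_on {s..t} (\<lambda>r. h r - thr r)" by (intro continuous_intros h thr)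
  from IVT'[of "\<lambda>r. h r - thr r" s 0 t, OF _ _ st cont] assms(4,5)
  have "?K \<noteq> {}" by auto
  moreover have "compact ?K"
  proof -
    have "closed ({s..t} \<inter> (\<lambda>r. h r - thr r) -` {0})"
      by (rule continuous_closed_preimage[OF cont]) auto
    moreover have "?K = {s..t} \<inter> (\<lambda>r. h r - thr r) -` {0}" by auto
    ultimately show ?thesis
      by (metis (no_types, lifting) compact_Icc compact_Int_closed inf.left_idem)
  qed
  ultimately obtain r where r: "r \<in> ?K" "\<And>q. q \<in> ?K \<Longrightarrow> r \<le> q"
    using compact_attains_inf[of ?K] by blast
  have "s < r" using r(1) assms(4) by (cases "s = r") auto
  moreover have "h q \<noteq> thr q" if "s < q" "q < r" for q
    using r(2)[of q] r(1) that by auto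
  ultimately have "first_hitting h thr s r"
    using r(1) by (simp add: first_hitting_def)
  with r(1) show thesis by (intro that) auto
qed

lemma unreset_model_at:
  assumes "unreset_model A s v z" "s < t"
  shows "(z has_vector_derivative A *v z t) (at t)"
proof -
  have "(z has_vector_derivative A *v z t) (at t within {s..})"
    using assms by (auto simp: unreset_model_def)
  then have "(z has_vector_derivative A *v z t) (at t within {s<..})"
    by (rule has_vector_derivative_within_subset) auto
  then show ?thesis using assms(2) by (simp add: at_within_open[of t "{s<..}"])
qed

locale triggered_execution =
  fixes A :: "real^'n^'n" and B :: "real^'m^'n" and F :: "real^'n^'m" and c :: real
    and G :: "('N::finite \<times> 'N) set" and thr :: "real \<Rightarrow> real" and T :: ereal
    and x y :: "'N \<Rightarrow> real \<Rightarrow> real^'n" and ev :: "'N \<Rightarrow> real set"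
  assumes execution: "execution A B F c G thr T x y ev"
    and thr_pos: "\<And>t. 0 < thr t" and thr_continuous: "\<And>X. continuous_on X thr"
begin

lemma zero_event: "0 \<in> ev i"
  and event_range: "t \<in> ev i \<Longrightarrow> 0 \<le> t \<and> ereal t < T"
  using execution[unfolded execution_def, THEN conjunct2, THEN conjunct1] by blast+

lemma finite_events: "ereal s < T \<Longrightarrow> finite (ev i \<inter> {..s})"
  using execution[unfolded execution_def, THEN conjunct2, THEN conjunct2, THEN conjunct1,
      THEN spec, THEN spec, THEN mp] .

lemma state_continuous: "continuous_on {t. 0 \<le> t \<and> ereal t < T} (x i)"
  using execution[unfolded execution_def, THEN conjunct2, THEN conjunct2, THEN conjunct2,
      THEN conjunct1, THEN spec] .

lemma state_derivative:
  assumes "0 \<le> t" "ereal t < T" "\<And>j. t \<notin> ev j"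
  shows "(x i has_vector_derivative A *v x i t + B *v control_input c F G y i t) (at t)"
  using execution[unfolded execution_def, THEN conjunct2, THEN conjunct2, THEN conjunct2,
      THEN conjunct2, THEN conjunct1, THEN spec, THEN spec, THEN mp] assms by blast

lemma event_model:
  assumes "s \<in> ev i"
  obtains z where "unreset_model A s (x i s) z"
    "\<And>t. s \<le> t \<Longrightarrow> ereal t < T \<Longrightarrow> ev i \<inter> {s<..t} = {} \<Longrightarrow> y i t = z t"
    "\<And>t. s < t \<Longrightarrow> ereal t < T \<Longrightarrow>
       consecutive_events (ev i) s t \<longleftrightarrow> first_hitting (\<lambda>r. norm (z r - x i r)) thr s t"
  using execution[unfolded execution_def, THEN conjunct2, THEN conjunct2, THEN conjunct2,
      THEN conjunct2, THEN conjunct2, THEN spec, THEN bspec, OF assms]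
proof (elim exE conjE)
  fix z
  assume z: "unreset_model A s (x i s) z"
    "\<forall>t\<ge>s. ereal t < T \<and> ev i \<inter> {s<..t} = {} \<longrightarrow> y i t = z t"
    "\<forall>t>s. ereal t < T \<longrightarrow>
       (consecutive_events (ev i) s t \<longleftrightarrow> first_hitting (\<lambda>r. norm (z r - x i r)) thr s t)"
  show thesis
    by (rule that[OF z(1)]) (simp_all add: z(2,3))
qed

lemma below_horizon: "0 \<le> s \<Longrightarrow> ereal t < T \<Longrightarrow> {s..t} \<subseteq> {t. 0 \<le> t \<and> ereal t < T}"
  by (auto intro: le_less_trans[of _ "ereal t"])

lemma last_event:
  assumes "0 \<le> t" "ereal t < T"
  obtains s where "s \<in> ev i" "s \<le> t" "ev i \<inter> {s<..t} = {}"
proof -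
  let ?E = "ev i \<inter> {..t}"
  have fin: "finite ?E" and ne: "?E \<noteq> {}"
    using assms zero_event finite_events by auto
  have "Max ?E \<in> ?E" by (rule Max_in[OF fin ne])
  moreover have "ev i \<inter> {Max ?E<..t} = {}"
  proof -
    have "r \<le> Max ?E" if "r \<in> ev i" "r \<le> t" for r using that by (intro Max_ge[OF fin]) auto
    then show ?thesis by fastforce
  qed
  ultimately show thesis by (intro that[of "Max ?E"]) auto
qed

lemma unreset_model_continuous:
  assumes "unreset_model A s v z" "s \<le> a"
  shows "continuous_on {a..b} z"
proof -
  have "continuous_on {s..} z"
    by (rule continuous_on_vector_derivative[where f' = "\<lambda>t. A *v z t"])
       (use assms(1) in \<open>auto simp: unreset_model_def\<close>)
  then show ?thesis by (rule continuous_on_subset) (use assms(2) in auto)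
qed

text \<open>The error of the unreset model starts at \<open>0\<close>, below the threshold. If it were not below the threshold at
time \<open>t\<close>, it would have had a first hitting time in between, and that would have been an event.\<close>

lemma error_below_threshold_until_event:
  assumes s: "s \<in> ev i" and z: "unreset_model A s (x i s) z"
    and hit: "\<And>t. s < t \<Longrightarrow> ereal t < T \<Longrightarrow>
       consecutive_events (ev i) s t \<longleftrightarrow> first_hitting (\<lambda>r. norm (z r - x i r)) thr s t"
    and t: "s \<le> t" "ereal t < T" and no: "ev i \<inter> {s<..t} = {}"
  shows "norm (z t - x i t) < thr t"
proof (rule ccontr)
  assume "\<not> norm (z t - x i t) < thr t"
  then have ge: "thr t \<le> norm (z t - x i t)" by simp
  let ?h = "\<lambda>r. norm (z r - x i r)"
  have s0: "0 \<le> s" using event_range[OF s] by simp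
  have "continuous_on {s..t} ?h"
    by (intro continuous_intros unreset_model_continuous[OF z order_refl]
        continuous_on_subset[OF state_continuous below_horizon[OF s0 t(2)]])
  moreover have "?h s < thr s" using z thr_pos by (simp add: unreset_model_def)
  ultimately obtain r where r: "r \<le> t" "first_hitting ?h thr s r"
    using ge by (rule first_hitting_exists[OF t(1) _ thr_continuous])
  then have "s < r" by (simp add: first_hitting_def)
  moreover have "ereal r < T" using r(1) by (intro le_less_trans[OF _ t(2)]) simp
  ultimately have "r \<in> ev i" using r hit by (auto simp: consecutive_events_def)
  with no \<open>s < r\<close> r(1) show False by auto
qed

lemma error_le_threshold:
  assumes "0 \<le> t" "ereal t < T"
  shows "norm (y i t - x i t) \<le> thr t"
proof -
  obtain s where s: "s \<in> ev i" "s \<le> t" "ev i \<inter> {s<..t} = {}" using assms by (rule last_event)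
  obtain z where z: "unreset_model A s (x i s) z"
    "\<And>t. s \<le> t \<Longrightarrow> ereal t < T \<Longrightarrow> ev i \<inter> {s<..t} = {} \<Longrightarrow> y i t = z t"
    "\<And>t. s < t \<Longrightarrow> ereal t < T \<Longrightarrow>
       consecutive_events (ev i) s t \<longleftrightarrow> first_hitting (\<lambda>r. norm (z r - x i r)) thr s t"
    by (rule event_model[OF s(1)]) blast
  show ?thesis
    using error_below_threshold_until_event[OF s(1) z(1,3) s(2) assms(2) s(3)] z(2)[OF s(2) assms(2) s(3)]
    by simp
qed

end

section \<open>The Laplacian in Jordan coordinates\<close>

lemma laplacian_sum:
  fixes v :: "'N::finite \<Rightarrow> 'a::real_vector"
  shows "(\<Sum>j\<in>UNIV. laplacian G $ i $ j *\<^sub>R v j) = (\<Sum>j\<in>neighbors G i. v i - v j)"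
proof -
  have "(\<Sum>j\<in>UNIV. degree_matrix G $ i $ j *\<^sub>R v j) = real (card (neighbors G i)) *\<^sub>R v i"
    by (simp add: degree_matrix_def adjacency_def neighbors_def if_distrib[of "\<lambda>x. x *\<^sub>R _"] cong: if_cong)
  moreover have "(\<Sum>j\<in>UNIV. adjacency G $ i $ j *\<^sub>R v j) = (\<Sum>j\<in>neighbors G i. v j)"
    by (simp add: adjacency_def neighbors_def if_distrib[of "\<lambda>x. x *\<^sub>R _"] sum.If_cases cong: if_cong)
  ultimately show ?thesis
    by (simp add: laplacian_def scaleR_diff_left sum_subtractf sum_constant_scaleR)
qed

text \<open>The rows of the inverse transformation that belong to the nonzero eigenvalues. Multiplication of
  block vectors by \<open>kron (tail_rows S) (mat 1)\<close> gives \<open>xhat_tail\<close>, and the lemmas below express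
  the matrices \<open>\<Delta>\<close> and \<open>\<Theta>\<close> and the Laplacian through these rows.\<close>

definition tail_rows :: "complex^('k::finite option)^'N::finite \<Rightarrow> complex^'N^'k" where
  "tail_rows S = (\<chi> p j. matrix_inv S $ Some p $ j)"

lemma UNIV_option_sum:
  fixes f :: "'k::finite option \<Rightarrow> 'a::comm_monoid_add"
  shows "(\<Sum>j\<in>UNIV. f j) = f None + (\<Sum>q\<in>UNIV. f (Some q))"
  by (simp add: UNIV_option_conv sum.reindex)

lemma zero_left_inv: "zero_left J ** matrix_inv S = J ** tail_rows S"
  by (simp add: Finite_Cartesian_Product.vec_eq_iff matrix_matrix_mult_def zero_left_def tail_rows_def UNIV_option_sum)

lemma Delta_mat_eq: "Delta_mat S J = J ** tail_rows S"
  by (simp add: Delta_mat_def zero_left_inv)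

lemma xhat_tail_eq:
  fixes S :: "complex^('k::finite option)^'N::finite" and v :: "'N \<Rightarrow> real^'n::finite"
  assumes "invertible S"
  shows "xhat_tail S v = kron (tail_rows S) (mat 1) *v stack v"
  by (auto simp: Finite_Cartesian_Product.vec_eq_iff xhat_tail_def xhat_def matrix_inv_kron_id[OF assms]
      kron_id_vector_nth tail_rows_def)

context
  fixes S :: "complex^('k::finite option)^'N::finite" and J :: "complex^'k^'k" and L :: "complex^'N^'N"
  assumes S: "invertible S" and SJ: "matrix_inv S ** L ** S = block_zero J"
begin

lemma inv_mult_L: "matrix_inv S ** L = block_zero J ** matrix_inv S"
  by (metis SJ S invertible_matrix_inv(1) matrix_mul_assoc matrix_mul_rid)

lemma tail_rows_mult_L: "tail_rows S ** L = J ** tail_rows S"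
proof -
  have "(tail_rows S ** L) $ p $ j = (J ** tail_rows S) $ p $ j" for p j
  proof -
    have "(tail_rows S ** L) $ p $ j = (matrix_inv S ** L) $ Some p $ j"
      by (simp add: matrix_matrix_mult_def tail_rows_def)
    also have "\<dots> = (J ** tail_rows S) $ p $ j"
      unfolding inv_mult_L
      by (simp add: matrix_matrix_mult_def tail_rows_def block_zero_def UNIV_option_sum)
    finally show ?thesis .
  qed
  then show ?thesis by (simp add: Finite_Cartesian_Product.vec_eq_iff)
qed

text \<open>This is how the disagreement \<open>L x\<close> is read off from the tail coordinates alone.\<close>

lemma Theta_mult_tail_rows: "Theta_mat S J ** tail_rows S = L"
proof -
  have "zero_top J ** tail_rows S = block_zero J ** matrix_inv S"
    by (auto simp: Finite_Cartesian_Product.vec_eq_iff matrix_matrix_mult_def zero_top_def tail_rows_def block_zero_def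
        UNIV_option_sum split: option.split)
  then have "Theta_mat S J ** tail_rows S = S ** (matrix_inv S ** L)"
    by (simp add: Theta_mat_def inv_mult_L flip: matrix_mul_assoc)
  then show ?thesis by (simp add: matrix_mul_assoc invertible_matrix_inv[OF S])
qed

lemma first_column_kernel: "L *v (\<chi> i. S $ i $ None) = 0"
proof -
  have "L ** S = S ** block_zero J"
    by (metis SJ S invertible_matrix_inv(1) matrix_mul_assoc matrix_mul_lid)
  then have "(L ** S) $ i $ None = 0" for i
    by (simp add: matrix_matrix_mult_def block_zero_def UNIV_option_sum)
  then show ?thesis by (simp add: Finite_Cartesian_Product.vec_eq_iff matrix_matrix_mult_def matrix_vector_mult_def)
qed

end

section \<open>The kernel of the Laplacian\<close>

text \<open>Maximum principle: where a kernel vector is maximal, each summand of its Laplacian is nonnegative, so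
  that it is maximal at all neighbors too. Following a path from the root backwards carries
  the maximum to the root.\<close>

lemma laplacian_kernel_le_root:
  fixes u :: "'N::finite \<Rightarrow> real"
  assumes ker: "\<And>i. (\<Sum>j\<in>neighbors G i. u i - u j) = 0" and root: "\<And>i. (r, i) \<in> G\<^sup>*"
  shows "u i \<le> u r"
proof -
  obtain m where m: "\<And>j. u j \<le> u m"
  proof -
    have "Max (range u) \<in> range u" by (rule Max_in) auto
    then obtain m where m: "Max (range u) = u m" by (rule imageE)
    show thesis by (intro that[of m]) (simp flip: m)
  qed
  have "(r, m) \<in> G\<^sup>*" by (rule root)
  then have "u r = u m"
  proof (induction rule: converse_rtrancl_induct)
    case (step a b)
    have "(\<Sum>j\<in>neighbors G b. u b - u j) = 0" by (rule ker)
    then have "\<forall>j\<in>neighbors G b. u b - u j = 0"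
      by (subst (asm) sum_nonneg_eq_0_iff) (use m step.IH in auto)
    then show ?case using step by (simp add: neighbors_def)
  qed simp
  with m show ?thesis by simp
qed

lemma laplacian_kernel_constant:
  fixes u :: "'N::finite \<Rightarrow> real"
  assumes "has_directed_spanning_tree G" and ker: "\<And>i. (\<Sum>j\<in>neighbors G i. u i - u j) = 0"
  shows "u i = u j"
proof -
  obtain r where r: "\<And>i. (r, i) \<in> G\<^sup>*" using assms(1) by (auto simp: has_directed_spanning_tree_def)
  have "(\<Sum>j\<in>neighbors G i. - u i - - u j) = - (\<Sum>j\<in>neighbors G i. u i - u j)" for i
    by (simp flip: sum_negf)
  then have "- u i \<le> - u r" for i
    by (intro laplacian_kernel_le_root[of "\<lambda>i. - u i" G]) (simp_all add: r ker)
  with laplacian_kernel_le_root[of u G, OF ker r] have eq: "u i = u r" for i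
    by (simp add: antisym)
  show ?thesis by (simp add: eq[of i] eq[of j])
qed

lemma complex_laplacian_kernel_constant:
  assumes "has_directed_spanning_tree G" and v: "cmat (laplacian G) *v v = 0"
  shows "v $ i = v $ j"
proof -
  have ker: "(\<Sum>j\<in>neighbors G i. v $ i - v $ j) = 0" for i
    using arg_cong[OF v, of "\<lambda>w. w $ i"] laplacian_sum[of G i "\<lambda>j. v $ j"]
    by (simp add: matrix_vector_mult_def cmat_def scaleR_conv_of_real)
  have "(\<Sum>j\<in>neighbors G i. Re (v $ i) - Re (v $ j)) = 0"
    "(\<Sum>j\<in>neighbors G i. Im (v $ i) - Im (v $ j)) = 0" for i
    using arg_cong[OF ker, of Re i] arg_cong[OF ker, of Im i] by simp_all
  from laplacian_kernel_constant[OF assms(1) this(1)] laplacian_kernel_constant[OF assms(1) this(2)]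
  show ?thesis by (intro complex_eqI)
qed

section \<open>Disagreement and error estimates along an execution\<close>

lemma control_effect:
  "B *v control_input c F G y i t = (c *\<^sub>R (B ** F)) *v (\<Sum>j\<in>neighbors G i. y i t - y j t)"
proof -
  have "B ** (c *\<^sub>R F) = c *\<^sub>R (B ** F)"
    by (simp add: Finite_Cartesian_Product.vec_eq_iff matrix_matrix_mult_def sum_distrib_left mult_ac)
  then show ?thesis by (simp add: control_input_def matrix_vector_mul_assoc)
qed

lemma kron_scaleR_cmat: "kron (r *\<^sub>R M) (cmat K) = kron M (cmat (r *\<^sub>R K))"
  by (simp add: Finite_Cartesian_Product.vec_eq_iff kron_def cmat_def scaleR_conv_of_real[where 'a = complex] mult_ac)

text \<open>An execution with exponential threshold, together with the coordinates that put the Laplacian into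
  the block form \<open>[0 0; 0 J]\<close> and an exponential decay rate for the resulting closed-loop matrix \<open>Ahat\<close> of
  the tail coordinates. The horizon \<open>T\<close> is arbitrary, so that every estimate also applies to executions
  whose continuation beyond a finite \<open>T\<close> is still in question.\<close>

locale decaying_execution = triggered_execution A B F c G "\<lambda>t. \<beta> * exp (- lam * t)" T x y ev
  for A :: "real^'n^'n" and B :: "real^'m^'n" and F :: "real^'n^'m" and c :: real
    and G :: "('N::finite \<times> 'N) set" and \<beta> lam :: real and T :: ereal
    and x y :: "'N \<Rightarrow> real \<Rightarrow> real^'n" and ev :: "'N \<Rightarrow> real set" +
  fixes S :: "complex^('k::finite option)^'N" and J :: "complex^'k^'k" and betah lamh K1 K2 :: real
    and K3 :: "real \<Rightarrow> real"
    and Ahat :: "complex^('k \<times> 'n)^('k \<times> 'n)" and Bhat :: "complex^('N \<times> 'n)^('k \<times> 'n)"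
  assumes S: "invertible S" and SJ: "matrix_inv S ** cmat (laplacian G) ** S = block_zero J"
    and Ahat: "Ahat = kron (mat 1) (cmat A) + kron (c *\<^sub>R J) (cmat (B ** F))"
    and Bhat: "Bhat = kron (c *\<^sub>R Delta_mat S J) (cmat (B ** F))"
    and decay: "\<And>t. t \<ge> 0 \<Longrightarrow> mat_norm (mat_exp (t *\<^sub>R Ahat)) \<le> betah * exp (- lamh * t)"
    and betah: "0 < betah" and beta: "0 < \<beta>" and lam: "0 < lam" "lam < lamh"
    and K1: "K1 = mat_norm (Theta_mat S J) * (betah * norm (xhat_tail S (\<lambda>i. x i 0))
           - sqrt (real CARD('N)) * \<beta> * betah * mat_norm Bhat / (lamh - lam))"
    and K2: "K2 = mat_norm (Theta_mat S J) * (sqrt (real CARD('N)) * \<beta> * betah * mat_norm Bhat / (lamh - lam))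
           + mat_norm (laplacian G) * sqrt (real CARD('N)) * \<beta>"
    and K3: "K3 = (\<lambda>s. mat_norm (c *\<^sub>R (B ** F)) *
           (K1 * exp ((lam - lamh) * s) / (mat_norm A + lamh) + K2 / (mat_norm A + lam)))"
begin

definition state where "state t = stack (\<lambda>i. x i t)"
definition error where "error t = stack (\<lambda>i. y i t - x i t)"
definition tail where "tail t = xhat_tail S (\<lambda>i. x i t)"

lemma tail_eq: "tail t = kron (tail_rows S) (mat 1) *v state t"
  by (simp add: tail_def state_def xhat_tail_eq[OF S])

lemma norm_error_le:
  assumes "0 \<le> t" "ereal t < T"
  shows "norm (error t) \<le> sqrt (real CARD('N)) * (\<beta> * exp (- lam * t))"
  unfolding error_def by (rule norm_stack_le) (rule error_le_threshold[OF assms])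

lemma state_has_vector_derivative:
  assumes "0 \<le> t" "ereal t < T" "\<And>j. t \<notin> ev j"
  shows "(state has_vector_derivative kron (mat 1) (cmat A) *v state t +
    kron (cmat (laplacian G)) (cmat (c *\<^sub>R (B ** F))) *v (state t + error t)) (at t)"
proof -
  let ?K = "c *\<^sub>R (B ** F)"
  have "B *v control_input c F G y i t = (\<Sum>j\<in>UNIV. laplacian G $ i $ j *\<^sub>R (?K *v y j t))" for i
  proof -
    have "B *v control_input c F G y i t = ?K *v (\<Sum>j\<in>UNIV. laplacian G $ i $ j *\<^sub>R y j t)"
      by (simp only: control_effect laplacian_sum)
    then show ?thesis
      by (simp add: linear_sum[OF matrix_vector_mul_linear] linear_scale[OF matrix_vector_mul_linear])
  qed
  then have input: "stack (\<lambda>i. B *v control_input c F G y i t) =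
      kron (cmat (laplacian G)) (cmat ?K) *v stack (\<lambda>i. y i t)"
    by (simp add: kron_stack)
  have drift: "stack (\<lambda>i. A *v x i t) = kron (mat 1) (cmat A) *v state t"
  proof -
    have "(\<Sum>j\<in>UNIV. (mat 1 :: real^'N^'N) $ i $ j *\<^sub>R (A *v x j t)) = A *v x i t" for i
      by (simp add: Finite_Cartesian_Product.mat_def if_distrib[of "\<lambda>r. r *\<^sub>R _"] cong: if_cong)
    then show ?thesis
      using kron_stack[of "mat 1 :: real^'N^'N" A "\<lambda>i. x i t"] by (simp add: cmat_mat_1 state_def)
  qed
  have y: "stack (\<lambda>i. y i t) = state t + error t"
    by (simp add: state_def error_def flip: stack_add)
  have "((\<lambda>t. stack (\<lambda>i. x i t)) has_vector_derivative
      stack (\<lambda>i. A *v x i t + B *v control_input c F G y i t)) (at t)"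
    by (intro stack_has_vector_derivative state_derivative assms)
  then show ?thesis
    by (simp add: stack_add drift input y state_def[abs_def])
qed

text \<open>The rows of the inverse transformation turn the Laplacian into \<open>J\<close>. So the tail coordinates satisfy a
closed equation, in which the local errors are the only forcing.\<close>

lemma tail_has_vector_derivative:
  assumes "0 \<le> t" "ereal t < T" "\<And>j. t \<notin> ev j"
  shows "(tail has_vector_derivative Ahat *v tail t + Bhat *v error t) (at t)"
proof -
  let ?R = "kron (tail_rows S) (mat 1)" and ?L = "cmat (laplacian G)"
  let ?BF = "cmat (c *\<^sub>R (B ** F))"
  have "((\<lambda>t. ?R *v state t) has_vector_derivative ?R *v (kron (mat 1) (cmat A) *v state t +
    kron ?L ?BF *v (state t + error t))) (at t)"
    by (rule bounded_linear.has_vector_derivative[OF matrix_vector_mul_bounded_linear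
          state_has_vector_derivative[OF assms]])
  moreover have "?R *v (kron (mat 1) (cmat A) *v state t + kron ?L ?BF *v (state t + error t)) =
      Ahat *v tail t + Bhat *v error t"
    unfolding tail_eq Ahat Bhat Delta_mat_eq kron_scaleR_cmat matrix_vector_right_distrib
      matrix_vector_mult_add_rdistrib
    by (simp add: matrix_vector_mul_assoc kron_mult tail_rows_mult_L[OF S SJ])
  ultimately show ?thesis by (simp add: tail_eq[abs_def])
qed

lemma continuous_on_tail:
  assumes "0 \<le> s" "ereal t < T"
  shows "continuous_on {s..t} tail"
proof -
  have "continuous_on {s..t} state"
    unfolding state_def
    by (intro continuous_on_stack continuous_on_subset[OF state_continuous below_horizon[OF assms]])
  then show ?thesis
    unfolding tail_eq[abs_def]
    by (rule bounded_linear.continuous_on[OF matrix_vector_mul_bounded_linear])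
qed

lemma finite_all_events: "ereal t < T \<Longrightarrow> finite (\<Union>j. ev j \<inter> {..t})"
  by (intro finite_UN_I finite_events) auto

text \<open>The forcing decays at the rate \<open>lam\<close> of the threshold, more slowly than the flow. Transported to time
\<open>t\<close>, its majorant is a constant multiple of the exponential of \<open>- lamh * t + (lamh - lam) * r\<close>,
whose antiderivative is explicit and produces the denominator \<open>lamh - lam\<close>.\<close>

lemma norm_tail_le:
  assumes t: "0 \<le> t" "ereal t < T"
  shows "norm (tail t) \<le> betah * norm (tail 0) * exp (- lamh * t) +
    sqrt (real CARD('N)) * \<beta> * betah * mat_norm Bhat / (lamh - lam) * (exp (- lam * t) - exp (- lamh * t))"
proof -
  define D where "D = sqrt (real CARD('N)) * \<beta> * betah * mat_norm Bhat / (lamh - lam)"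
  have flow: "norm (flow ((*v) Ahat) u v) \<le> betah * exp (- lamh * u) * norm v" if "u \<ge> 0" for u v
  proof -
    have "norm (flow ((*v) Ahat) u v) \<le> mat_norm (mat_exp (u *\<^sub>R Ahat)) * norm v"
      using norm_matrix_vector_le[of "mat_exp (u *\<^sub>R Ahat)" v] by (simp add: mat_exp_mult_vector)
    also have "\<dots> \<le> betah * exp (- lamh * u) * norm v"
      by (intro mult_right_mono decay that) simp
    finally show ?thesis .
  qed
  \<comment> \<open>the antiderivative of the transported forcing\<close>
  let ?g = "\<lambda>r. D * exp (- lamh * t + (lamh - lam) * r)"
  have "norm (tail t - flow ((*v) Ahat) (t - 0) (tail 0)) \<le> ?g t - ?g 0"
  proof (rule variation_of_constants_bound[where b = betah and \<kappa> = "- lamh"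
        and E = "\<Union>j. ev j \<inter> {..t}" and w = "\<lambda>r. Bhat *v error r"
        and W = "\<lambda>r. mat_norm Bhat * (sqrt (real CARD('N)) * (\<beta> * exp (- lam * r)))"])
    fix r assume r: "r \<in> {0<..<t} - (\<Union>j. ev j \<inter> {..t})"
    then have r': "0 \<le> r" "ereal r < T" "\<And>j. r \<notin> ev j"
      using below_horizon[OF order_refl t(2)] subsetD[OF below_horizon[OF order_refl t(2)], of r] by auto
    from tail_has_vector_derivative[OF this]
    show "(tail has_vector_derivative Ahat *v tail r + Bhat *v error r) (at r)" .
    have "norm (Bhat *v error r) \<le> mat_norm Bhat * norm (error r)" by (rule norm_matrix_vector_le)
    also have "\<dots> \<le> mat_norm Bhat * (sqrt (real CARD('N)) * (\<beta> * exp (- lam * r)))"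
      by (intro mult_left_mono norm_error_le r' mat_norm_nonneg)
    finally show "norm (Bhat *v error r) \<le> \<dots>" .
  next
    fix r
    have "(?g has_real_derivative D * exp (- lamh * t + (lamh - lam) * r) * (lamh - lam)) (at r)"
      by (auto intro!: derivative_eq_intros)
    moreover have "D * exp (- lamh * t + (lamh - lam) * r) * (lamh - lam) =
        betah * exp (- lamh * (t - r)) * (mat_norm Bhat * (sqrt (real CARD('N)) * (\<beta> * exp (- lam * r))))"
    proof -
      have "D * (lamh - lam) = sqrt (real CARD('N)) * \<beta> * betah * mat_norm Bhat"
        using lam by (simp add: D_def)
      moreover have "exp (- lamh * t + (lamh - lam) * r) = exp (- lamh * (t - r)) * exp (- lam * r)"
        by (simp add: algebra_simps flip: exp_add)
      ultimately show ?thesis by (simp add: mult_ac)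
    qed
    ultimately show "(?g has_real_derivative betah * exp (- lamh * (t - r)) *
        (mat_norm Bhat * (sqrt (real CARD('N)) * (\<beta> * exp (- lam * r))))) (at r)"
      by simp
  qed (use t flow finite_all_events continuous_on_tail in auto)
  moreover have "?g t - ?g 0 = D * (exp (- lam * t) - exp (- lamh * t))"
    by (simp add: algebra_simps)
  ultimately show ?thesis
    using norm_triangle_sub[of "tail t" "flow ((*v) Ahat) (t - 0) (tail 0)"] flow[OF t(1), of "tail 0"]
    by (simp add: D_def mult_ac)
qed

lemma K2_nonneg: "0 \<le> K2" and K1_K2_nonneg: "0 \<le> K1 + K2"
proof -
  have D: "0 \<le> sqrt (real CARD('N)) * \<beta> * betah * mat_norm Bhat / (lamh - lam)"
    using beta betah lam mat_norm_nonneg[of Bhat] by simp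
  have L: "0 \<le> mat_norm (laplacian G) * sqrt (real CARD('N)) * \<beta>"
    using beta mat_norm_nonneg[of "laplacian G"] by simp
  show "0 \<le> K2" unfolding K2
    using mult_nonneg_nonneg[OF mat_norm_nonneg[of "Theta_mat S J"] D] L by simp
  have "K1 + K2 = mat_norm (Theta_mat S J) * (betah * norm (xhat_tail S (\<lambda>i. x i 0)))
      + mat_norm (laplacian G) * sqrt (real CARD('N)) * \<beta>"
    unfolding K1 K2 by (simp add: algebra_simps)
  also have "0 \<le> \<dots>"
    using L betah mat_norm_nonneg[of "Theta_mat S J"] by simp
  finally show "0 \<le> K1 + K2" .
qed

lemma norm_laplacian_error_le:
  assumes t: "0 \<le> t" "ereal t < T"
  shows "norm (\<Sum>j\<in>neighbors G i. (y i t - x i t) - (y j t - x j t)) \<le>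
    mat_norm (laplacian G) * (sqrt (real CARD('N)) * (\<beta> * exp (- lam * t)))"
proof -
  define w where "w = (\<chi> p. (y (fst p) t - x (fst p) t) $ snd p)"
  have norm_w: "norm w = norm (error t)"
    by (simp add: norm_vec_def w_def error_def stack_def flip: of_real_diff)
  have "(\<Sum>j\<in>neighbors G i. (y i t - x i t) - (y j t - x j t)) $ q = (kron (laplacian G) (mat 1) *v w) $ (i, q)" for q
  proof -
    have "(\<Sum>j\<in>neighbors G i. (y i t - x i t) - (y j t - x j t)) =
        (\<Sum>j\<in>UNIV. laplacian G $ i $ j *\<^sub>R (y j t - x j t))"
      using laplacian_sum[of G i "\<lambda>i. y i t - x i t"] by simp
    then show ?thesis by (simp add: kron_id_vector_nth w_def)
  qed
  then have "(\<Sum>j\<in>neighbors G i. (y i t - x i t) - (y j t - x j t)) = (\<chi> q. (kron (laplacian G) (mat 1) *v w) $ (i, q))"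
    by (simp add: Finite_Cartesian_Product.vec_eq_iff)
  then have "norm (\<Sum>j\<in>neighbors G i. (y i t - x i t) - (y j t - x j t)) \<le> norm (kron (laplacian G) (mat 1) *v w)"
    by (simp only: norm_block_le)
  also have "\<dots> \<le> mat_norm (laplacian G) * norm w" by (rule norm_kron_id_le)
  also have "\<dots> \<le> mat_norm (laplacian G) * (sqrt (real CARD('N)) * (\<beta> * exp (- lam * t)))"
    unfolding norm_w by (intro mult_left_mono norm_error_le t mat_norm_nonneg)
  finally show ?thesis .
qed

lemma norm_laplacian_state_le:
  "norm (\<Sum>j\<in>neighbors G i. x i t - x j t) \<le> mat_norm (Theta_mat S J) * norm (tail t)"
proof -
  let ?z = "kron (Theta_mat S J) (mat 1 :: complex^'n^'n) *v tail t"
  have z: "?z = kron (cmat (laplacian G)) (mat 1) *v state t"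
    by (simp add: tail_eq matrix_vector_mul_assoc kron_mult Theta_mult_tail_rows[OF S SJ])
  have "complex_of_real ((\<Sum>j\<in>neighbors G i. x i t - x j t) $ q) = ?z $ (i, q)" for q
    unfolding z laplacian_sum[symmetric, of "\<lambda>i. x i t" i G]
    by (simp add: kron_id_vector_nth cmat_def state_def stack_def)
  then have "norm (\<Sum>j\<in>neighbors G i. x i t - x j t) = norm (\<chi> q. ?z $ (i, q))"
    by (simp add: norm_vec_def flip: norm_of_real[where 'a = complex])
  also have "\<dots> \<le> norm ?z" by (rule norm_block_le)
  also have "\<dots> \<le> mat_norm (Theta_mat S J) * norm (tail t)" by (rule norm_kron_id_le)
  finally show ?thesis .
qed

text \<open>The input of agent \<open>i\<close> depends on the Laplacian of the models, which is the Laplacian of the states plus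
the Laplacian of the errors: the first is controlled by the tail coordinates, the second by the
threshold. The two resulting exponentials have exactly the coefficients \<open>K1\<close> and \<open>K2\<close>.\<close>

lemma norm_disagreement_le:
  assumes t: "0 \<le> t" "ereal t < T"
  shows "norm (\<Sum>j\<in>neighbors G i. y i t - y j t) \<le> K1 * exp (- lamh * t) + K2 * exp (- lam * t)"
proof -
  have split: "(\<Sum>j\<in>neighbors G i. y i t - y j t) = (\<Sum>j\<in>neighbors G i. x i t - x j t) +
      (\<Sum>j\<in>neighbors G i. (y i t - x i t) - (y j t - x j t))"
    by (simp add: algebra_simps flip: sum.distrib)
  define D where "D = sqrt (real CARD('N)) * \<beta> * betah * mat_norm Bhat / (lamh - lam)"
  let ?U = "betah * norm (tail 0) * exp (- lamh * t) + D * (exp (- lam * t) - exp (- lamh * t))"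
  let ?V = "mat_norm (laplacian G) * (sqrt (real CARD('N)) * (\<beta> * exp (- lam * t)))"
  have "norm (\<Sum>j\<in>neighbors G i. y i t - y j t) \<le> mat_norm (Theta_mat S J) * norm (tail t) + ?V"
    unfolding split
    by (rule norm_triangle_mono[OF norm_laplacian_state_le norm_laplacian_error_le[OF t]])
  also have "\<dots> \<le> mat_norm (Theta_mat S J) * ?U + ?V"
    unfolding D_def by (intro add_right_mono mult_left_mono norm_tail_le t mat_norm_nonneg)
  also have "\<dots> = K1 * exp (- lamh * t) + K2 * exp (- lam * t)"
    unfolding K1 K2 D_def[symmetric] tail_def by (simp add: algebra_simps)
  finally show ?thesis .
qed

end

section \<open>Time between events\<close>

text \<open>Multiplying by \<open>exp (lam * t)\<close>, and with \<open>E\<close>, \<open>p\<close> and \<open>q\<close> as in the proof, the hypothesis bounds \<open>\<beta>\<close> by \<open>k\<close> times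
the sum of \<open>K1 * p * q * (E - 1) / (a + lamh)\<close> and \<open>K2 * (E * q - 1) / (a + lam)\<close>, and the claim says that
\<open>q\<close> may be replaced by \<open>1\<close>. For \<open>K1 \<ge> 0\<close> this holds term by term, since \<open>q \<le> 1\<close>. But \<open>K1\<close> is negative
when the initial disagreement is small, and then the first term gets smaller; the gain in the
second term makes up for this because \<open>- K1 \<le> K2\<close> and \<open>a + lam < a + lamh\<close>.\<close>

lemma event_gap_estimate:
  fixes a \<beta> lam lamh k K1 K2 s t :: real
  assumes "0 \<le> a" "0 < lam" "lam < lamh" "0 \<le> k" "0 \<le> K2" "0 \<le> K1 + K2" "0 \<le> s" "s \<le> t"
    and le: "\<beta> * exp (- lam * t) \<le>
      k * (K1 * (exp (a * (t - s) - lamh * s) - exp (- lamh * t)) / (a + lamh)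
         + K2 * (exp (a * (t - s) - lam * s) - exp (- lam * t)) / (a + lam))"
  shows "\<beta> \<le> k * (K1 * exp ((lam - lamh) * s) / (a + lamh) + K2 / (a + lam)) * (exp ((a + lamh) * (t - s)) - 1)"
proof -
  define E where "E = exp ((a + lamh) * (t - s))"
  define p where "p = exp ((lam - lamh) * s)"
  define q where "q = exp ((lam - lamh) * (t - s))"
  have E: "1 \<le> E" and p: "0 < p" "p \<le> 1" and q: "0 < q" "q \<le> 1"
    using assms by (auto simp: E_def p_def q_def mult_nonpos_nonneg)
  have e1: "exp (lam * t) * (exp (a * (t - s) - lamh * s) - exp (- lamh * t)) = p * q * (E - 1)"
    by (simp add: E_def p_def q_def algebra_simps flip: exp_add)
  have e2: "exp (lam * t) * (exp (a * (t - s) - lam * s) - exp (- lam * t)) = E * q - 1"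
    by (simp add: E_def q_def algebra_simps flip: exp_add)
  have "exp (lam * t) * (\<beta> * exp (- lam * t)) \<le> exp (lam * t) *
      (k * (K1 * (exp (a * (t - s) - lamh * s) - exp (- lamh * t)) / (a + lamh)
         + K2 * (exp (a * (t - s) - lam * s) - exp (- lam * t)) / (a + lam)))"
    by (intro mult_left_mono le) simp
  also have "\<dots> = k * (K1 * (exp (lam * t) * (exp (a * (t - s) - lamh * s) - exp (- lamh * t))) / (a + lamh)
         + K2 * (exp (lam * t) * (exp (a * (t - s) - lam * s) - exp (- lam * t))) / (a + lam))"
    by (simp add: algebra_simps)
  also have "\<dots> = k * (K1 * (p * q * (E - 1)) / (a + lamh) + K2 * (E * q - 1) / (a + lam))"
    unfolding e1 e2 ..
  also have "\<dots> \<le> k * ((K1 * p / (a + lamh) + K2 / (a + lam)) * (E - 1))"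
  proof (rule mult_left_mono[OF _ \<open>0 \<le> k\<close>])
    have "- K2 \<le> K1 * p"
      using assms(5,6) p mult_left_mono[of p 1 K2] mult_right_mono[of "- K2" K1 p] by (simp add: mult.commute)
    then have "(E - 1) * (- K2) / (a + lamh) \<le> (E - 1) * (K1 * p) / (a + lamh)"
      using E assms by (intro divide_right_mono mult_left_mono) auto
    moreover have "(E - 1) * K2 / (a + lamh) \<le> E * K2 / (a + lam)"
      using E assms by (intro frac_le mult_right_mono) auto
    ultimately have "0 \<le> (E - 1) * (K1 * p) / (a + lamh) + E * K2 / (a + lam)"
      by simp
    with q have "0 \<le> (1 - q) * ((E - 1) * (K1 * p) / (a + lamh) + E * K2 / (a + lam))"
      by simp
    also have "\<dots> = (K1 * p / (a + lamh) + K2 / (a + lam)) * (E - 1)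
        - (K1 * (p * q * (E - 1)) / (a + lamh) + K2 * (E * q - 1) / (a + lam))"
      by (simp add: algebra_simps diff_divide_distrib add_divide_distrib)
    finally show "K1 * (p * q * (E - 1)) / (a + lamh) + K2 * (E * q - 1) / (a + lam)
        \<le> (K1 * p / (a + lamh) + K2 / (a + lam)) * (E - 1)" by simp
  qed
  also have "exp (lam * t) * (\<beta> * exp (- lam * t)) = \<beta>"
    by (simp add: exp_minus)
  finally show ?thesis
    by (simp add: E_def p_def mult.assoc)
qed

context decaying_execution
begin

text \<open>Between consecutive events the error of agent \<open>i\<close> starts at \<open>0\<close> and is driven only by the input of the
agent, while the flow of \<open>A\<close> grows at most at the rate \<open>mat_norm A\<close>. At the second event
it has grown to the threshold, so the driving bound must allow for that much growth.\<close>

lemma threshold_le_gap: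
  assumes ce: "consecutive_events (ev i) s t"
  shows "\<beta> \<le> K3 s * (exp ((mat_norm A + lamh) * (t - s)) - 1)"
proof -
  have s: "s \<in> ev i" "t \<in> ev i" "s < t" "ev i \<inter> {s<..<t} = {}"
    using ce by (auto simp: consecutive_events_def)
  then have st: "0 \<le> s" "ereal t < T" using event_range by auto
  obtain z where z: "unreset_model A s (x i s) z"
    and yz: "\<And>t. s \<le> t \<Longrightarrow> ereal t < T \<Longrightarrow> ev i \<inter> {s<..t} = {} \<Longrightarrow> y i t = z t"
    and hit: "\<And>t. s < t \<Longrightarrow> ereal t < T \<Longrightarrow>
       consecutive_events (ev i) s t \<longleftrightarrow> first_hitting (\<lambda>r. norm (z r - x i r)) (\<lambda>t. \<beta> * exp (- lam * t)) s t"
    using s(1) by (rule event_model) blast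
  define a where "a = mat_norm A"
  define k where "k = mat_norm (c *\<^sub>R (B ** F))"
  have a: "0 \<le> a" and k: "0 \<le> k" unfolding a_def k_def by (rule mat_norm_nonneg)+
  let ?W = "\<lambda>r. k * (K1 * exp (- lamh * r) + K2 * exp (- lam * r))"
  let ?g = "\<lambda>r. - (k * (K1 * (exp (a * t - (a + lamh) * r) / (a + lamh)) + K2 * (exp (a * t - (a + lam) * r) / (a + lam))))"
  have "norm ((z t - x i t) - flow ((*v) A) (t - s) (z s - x i s)) \<le> ?g t - ?g s"
  proof (rule variation_of_constants_bound[where b = 1 and \<kappa> = a and f = "\<lambda>r. z r - x i r"
        and E = "\<Union>j. ev j \<inter> {..t}" and w = "\<lambda>r. - (B *v control_input c F G y i r)" and W = ?W])
    show "norm (flow ((*v) A) u v) \<le> 1 * exp (a * u) * norm v" if "0 \<le> u" for u v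
      using norm_flow_le[OF matrix_vector_mul_bounded_linear that, of A v] by (simp add: a_def mat_norm_def)
    show "continuous_on {s..t} (\<lambda>r. z r - x i r)"
      by (intro continuous_intros unreset_model_continuous[OF z order_refl]
        continuous_on_subset[OF state_continuous below_horizon[OF st]])
  next
    fix r assume r: "r \<in> {s<..<t} - (\<Union>j. ev j \<inter> {..t})"
    then have r': "0 \<le> r" "ereal r < T" "\<And>j. r \<notin> ev j"
      using st(1) subsetD[OF below_horizon[OF st], of r] by auto
    have "(z has_vector_derivative A *v z r) (at r)"
      using unreset_model_at[OF z] r by auto
    from has_vector_derivative_diff[OF this state_derivative[OF r', of i]]
    show "((\<lambda>r. z r - x i r) has_vector_derivative A *v (z r - x i r) +
        - (B *v control_input c F G y i r)) (at r)"
      by (simp add: matrix_vector_mult_diff_distrib algebra_simps)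
    have "norm (B *v control_input c F G y i r) \<le> k * norm (\<Sum>j\<in>neighbors G i. y i r - y j r)"
      unfolding control_effect k_def by (rule norm_matrix_vector_le)
    also have "\<dots> \<le> ?W r"
      by (intro mult_left_mono norm_disagreement_le r' k)
    finally show "norm (- (B *v control_input c F G y i r)) \<le> ?W r" by simp
  next
    fix r
    have exp: "((\<lambda>r. exp (a * t - (a + b) * r) / (a + b)) has_real_derivative - (exp (a * (t - r)) * exp (- b * r))) (at r)"
      if "0 < b" for b
    proof -
      have "exp (a * t - (a + b) * r) = exp (a * (t - r)) * exp (- b * r)"
        by (simp add: algebra_simps flip: exp_add)
      moreover have "((\<lambda>r. exp (a * t - (a + b) * r) / (a + b)) has_real_derivative - exp (a * t - (a + b) * r)) (at r)"
      proof -
        have nz: "a + b \<noteq> 0" using a that by simp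
        have cancel: "u * (- d) / d = - u" if "d \<noteq> 0" for u d :: real using that by simp
        have "exp (a * t - (a + b) * r) * (- (a + b)) / (a + b) = - exp (a * t - (a + b) * r)"
          using nz by (rule cancel)
        moreover have "((\<lambda>r. exp (a * t - (a + b) * r) / (a + b)) has_real_derivative
            exp (a * t - (a + b) * r) * (- (a + b)) / (a + b)) (at r)"
          using nz by (auto intro!: derivative_eq_intros)
        ultimately show ?thesis by (simp only:)
      qed
      ultimately show ?thesis by simp
    qed
    have "(?g has_real_derivative - (k * (K1 * - (exp (a * (t - r)) * exp (- lamh * r))
        + K2 * - (exp (a * (t - r)) * exp (- lam * r))))) (at r)"
      using lam by (intro DERIV_minus DERIV_cmult DERIV_add exp) auto
    then show "(?g has_real_derivative 1 * exp (a * (t - r)) * ?W r) (at r)"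
      by (rule back_subst[where P = "\<lambda>d. (_ has_real_derivative d) _"]) (simp add: algebra_simps)
  next
    show "finite (\<Union>j. ev j \<inter> {..t})" by (rule finite_all_events[OF st(2)])
    show "s \<le> t" using s(3) by simp
  qed (rule matrix_vector_mul_bounded_linear)
  moreover have "z s - x i s = 0" using z by (simp add: unreset_model_def)
  moreover have "flow ((*v) A) (t - s) 0 = 0"
    by (rule linear_0[OF bounded_linear.linear[OF bounded_linear_flow[OF matrix_vector_mul_bounded_linear]]])
  moreover have "norm (z t - x i t) = \<beta> * exp (- lam * t)"
    using hit[OF s(3) st(2)] ce by (simp add: first_hitting_def)
  moreover have "?g t - ?g s = k * (K1 * (exp (a * (t - s) - lamh * s) - exp (- lamh * t)) / (a + lamh)
         + K2 * (exp (a * (t - s) - lam * s) - exp (- lam * t)) / (a + lam))"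
  proof -
    have "exp (a * t - (a + b) * s) = exp (a * (t - s) - b * s)" "exp (a * t - (a + b) * t) = exp (- b * t)" for b
      by (simp_all add: algebra_simps)
    then show ?thesis
      by (simp only:) (simp add: right_diff_distrib diff_divide_distrib distrib_left)
  qed
  ultimately have "\<beta> * exp (- lam * t) \<le> k * (K1 * (exp (a * (t - s) - lamh * s) - exp (- lamh * t)) / (a + lamh)
         + K2 * (exp (a * (t - s) - lam * s) - exp (- lam * t)) / (a + lam))"
    by simp
  then show ?thesis
    unfolding K3 a_def[symmetric] k_def[symmetric]
    using s(3) by (intro event_gap_estimate a lam k K2_nonneg K1_K2_nonneg st(1)) simp_all
qed

end

section \<open>Continuation of executions\<close>

text \<open>The difference of two solutions with the same forcing is a trajectory of the flow that starts at \<open>0\<close>.\<close>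

lemma perturbed_solution_unique:
  fixes A :: "real^'n^'n"
  assumes "finite E" "a \<le> t" "f a = g a" "continuous_on {a..t} f" "continuous_on {a..t} g"
    and "\<And>r. r \<in> {a<..<t} - E \<Longrightarrow> (f has_vector_derivative A *v f r + w r) (at r)"
    and "\<And>r. r \<in> {a<..<t} - E \<Longrightarrow> (g has_vector_derivative A *v g r + w r) (at r)"
  shows "f t = g t"
proof -
  have "f t - g t = flow ((*v) A) (t - a) (f a - g a)"
  proof (rule linear_solution_eq_flow[OF _ assms(1,2), where f = "\<lambda>r. f r - g r"])
    show "continuous_on {a..t} (\<lambda>r. f r - g r)" by (intro continuous_intros assms)
    show "((\<lambda>r. f r - g r) has_vector_derivative A *v (f r - g r)) (at r)" if "r \<in> {a<..<t} - E" for r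
      using has_vector_derivative_diff[OF assms(6,7)[OF that]]
      by (simp add: matrix_vector_mult_diff_distrib)
  qed (rule matrix_vector_mul_bounded_linear)
  also have "\<dots> = 0"
    unfolding assms(3) diff_self
    by (rule linear_0[OF bounded_linear.linear[OF bounded_linear_flow[OF matrix_vector_mul_bounded_linear]]])
  finally show ?thesis by simp
qed

text \<open>As long as no model is reset, states and models together form one autonomous linear system, so its flow
gives a solution for all times.\<close>

lemma closed_loop_solution:
  fixes A :: "real^'n^'n" and B :: "real^'m^'n" and F :: "real^'n^'m" and G :: "('N::finite \<times> 'N) set"
  obtains X Z where "\<And>i. X i s = x0 i" "\<And>i. Z i s = z0 i"
    "\<And>i t. (Z i has_vector_derivative A *v Z i t) (at t)"
    "\<And>i t. (X i has_vector_derivative A *v X i t + B *v control_input c F G Z i t) (at t)"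
proof -
  let ?K = "c *\<^sub>R (B ** F)"
  define L :: "(real^'n^'N) \<times> (real^'n^'N) \<Rightarrow> (real^'n^'N) \<times> (real^'n^'N)" where
    "L w = (\<chi> i. A *v (fst w $ i) + ?K *v (\<Sum>j\<in>neighbors G i. snd w $ i - snd w $ j),
            \<chi> i. A *v (snd w $ i))" for w
  have "linear L"
  proof (rule linearI)
    fix v w :: "(real^'n^'N) \<times> (real^'n^'N)" and r :: real
    have sum_add: "(\<Sum>j\<in>neighbors G i. (snd v $ i + snd w $ i) - (snd v $ j + snd w $ j)) =
        (\<Sum>j\<in>neighbors G i. snd v $ i - snd v $ j) + (\<Sum>j\<in>neighbors G i. snd w $ i - snd w $ j)" for i
      by (simp add: add_diff_add flip: sum.distrib)
    show "L (v + w) = L v + L w"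
      by (simp add: L_def sum_add Finite_Cartesian_Product.vec_eq_iff matrix_vector_right_distrib)
    have sum_scale: "(\<Sum>j\<in>neighbors G i. r *\<^sub>R snd v $ i - r *\<^sub>R snd v $ j) =
        r *\<^sub>R (\<Sum>j\<in>neighbors G i. snd v $ i - snd v $ j)" for i
      by (simp add: scaleR_sum_right scaleR_diff_right)
    show "L (r *\<^sub>R v) = r *\<^sub>R L v"
      by (simp add: L_def sum_scale Finite_Cartesian_Product.vec_eq_iff matrix_vector_mult_scaleR distrib_left)
  qed
  then have L: "bounded_linear L" by (simp add: linear_conv_bounded_linear)
  define W where "W t = flow L (t - s) (\<chi> i. x0 i, \<chi> i. z0 i)" for t
  have W: "(W has_vector_derivative L (W t)) (at t)" for t
    unfolding W_def[abs_def] by (rule flow_solves[OF L])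
  show thesis
  proof (rule that[of "\<lambda>i t. fst (W t) $ i" "\<lambda>i t. snd (W t) $ i"])
    fix i t
    show "fst (W s) $ i = x0 i" "snd (W s) $ i = z0 i" by (simp_all add: W_def)
    show "((\<lambda>t. snd (W t) $ i) has_vector_derivative A *v (snd (W t) $ i)) (at t)"
      using bounded_linear.has_vector_derivative[OF bounded_linear_vec_nth
          bounded_linear.has_vector_derivative[OF bounded_linear_snd W[of t]], of i]
      by (simp add: L_def)
    show "((\<lambda>t. fst (W t) $ i) has_vector_derivative A *v (fst (W t) $ i) +
        B *v control_input c F G (\<lambda>i t. snd (W t) $ i) i t) (at t)"
      using bounded_linear.has_vector_derivative[OF bounded_linear_vec_nth
          bounded_linear.has_vector_derivative[OF bounded_linear_fst W[of t]], of i]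
      by (simp add: L_def control_effect)
  qed
qed

lemma first_hitting_cong:
  assumes "\<And>r. s < r \<Longrightarrow> r \<le> t \<Longrightarrow> h r = h' r"
  shows "first_hitting h thr s t \<longleftrightarrow> first_hitting h' thr s t"
  using assms by (auto simp: first_hitting_def)

lemma control_input_cong:
  "(\<And>j. y j t = y' j t) \<Longrightarrow> control_input c F G y i t = control_input c F G y' i t"
  by (simp add: control_input_def)

context triggered_execution
begin

text \<open>Finitely many events leave a last one before the horizon \<open>\<theta>\<close>, at a time \<open>s0\<close>. After \<open>s0\<close> the
execution follows a linear system without resets, whose solution exists for all times and supplies the missing value at \<open>\<theta>\<close>. The
agents whose error meets the threshold at \<open>\<theta>\<close> (the set \<open>H\<close>) have an event there, and a second
linear system takes over from \<open>\<theta>\<close>. Its errors differ from the threshold at \<open>\<theta>\<close>, being \<open>0\<close>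
after a reset, so by continuity there is no further hitting before some \<open>b > \<theta>\<close>.\<close>

lemma extendable_beyond_finite_horizon:
  assumes T: "T = ereal \<theta>" and fin: "\<And>i. finite (ev i)"
  shows "\<exists>T' x' y' ev'. T < T' \<and> execution A B F c G thr T' x' y' ev' \<and>
    (\<forall>i t. 0 \<le> t \<and> ereal t < T \<longrightarrow> x' i t = x i t \<and> y' i t = y i t \<and> (t \<in> ev' i \<longleftrightarrow> t \<in> ev i))"
proof -
  have range: "0 \<le> t" "t < \<theta>" if "t \<in> ev i" for i t
    using event_range[OF that] T by auto
  define P where "P i s z \<longleftrightarrow> unreset_model A s (x i s) z \<and>
    (\<forall>t. s \<le> t \<longrightarrow> t < \<theta> \<longrightarrow> ev i \<inter> {s<..t} = {} \<longrightarrow> y i t = z t) \<and>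
    (\<forall>t. s < t \<longrightarrow> t < \<theta> \<longrightarrow>
       (consecutive_events (ev i) s t \<longleftrightarrow> first_hitting (\<lambda>r. norm (z r - x i r)) thr s t))" for i s z
  \<comment> \<open>the model that agent \<open>i\<close> starts at its event time \<open>s\<close>, followed without resets\<close>
  define model where "model i s = (SOME z. P i s z)" for i s
  have model: "P i s (model i s)" if "s \<in> ev i" for i s
  proof -
    have "\<exists>z. P i s z" using that by (rule event_model) (auto simp: P_def T)
    then show ?thesis unfolding model_def by (rule someI_ex)
  qed
  have unreset: "unreset_model A s (x i s) (model i s)" if "s \<in> ev i" for i s
    using model[OF that] by (simp add: P_def)
  have y_model: "y i t = model i s t" if "s \<in> ev i" "s \<le> t" "t < \<theta>" "ev i \<inter> {s<..t} = {}" for i s t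
    using model[OF that(1)] that by (simp add: P_def)
  have hit: "consecutive_events (ev i) s t \<longleftrightarrow> first_hitting (\<lambda>r. norm (model i s r - x i r)) thr s t"
    if "s \<in> ev i" "s < t" "t < \<theta>" for i s t
    using model[OF that(1)] that by (simp add: P_def)

  define last where "last i = Max (ev i)" for i
  have last: "last i \<in> ev i" and last_ge: "\<And>r. r \<in> ev i \<Longrightarrow> r \<le> last i" for i
    unfolding last_def using fin zero_event by (auto intro!: Max_in Max_ge)
  have after_last: "ev i \<inter> {last i<..t} = {}" for i t
    using last_ge by fastforce
  define \<zeta> where "\<zeta> i = model i (last i)" for i
  have \<zeta>: "unreset_model A (last i) (x i (last i)) (\<zeta> i)" for i
    unfolding \<zeta>_def by (rule unreset[OF last])
  define s0 where "s0 = Max (range last)"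
  have s0_ge: "last i \<le> s0" for i unfolding s0_def by (intro Max_ge) auto
  have "s0 \<in> range last" unfolding s0_def by (intro Max_in) auto
  then have s0: "0 \<le> s0" "s0 < \<theta>" using range[OF last] by auto

  \<comment> \<open>the execution since the last event of any agent, as a solution that exists beyond \<open>\<theta>\<close>\<close>
  obtain X Z where X0: "\<And>i. X i s0 = x i s0" and Z0: "\<And>i. Z i s0 = \<zeta> i s0"
    and Z: "\<And>i t. (Z i has_vector_derivative A *v Z i t) (at t)"
    and X: "\<And>i t. (X i has_vector_derivative A *v X i t + B *v control_input c F G Z i t) (at t)"
    using closed_loop_solution[of s0 "\<lambda>i. x i s0" "\<lambda>i. \<zeta> i s0" A B c F G] by metis
  have contX: "continuous_on U (X i)" for U i
    by (rule continuous_on_vector_derivative[OF has_vector_derivative_at_within[OF X]])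
  have contZ: "continuous_on U (Z i)" for U i
    by (rule continuous_on_vector_derivative[OF has_vector_derivative_at_within[OF Z]])
  have Z_eq: "Z i t = \<zeta> i t" if "s0 \<le> t" for i t
  proof (rule perturbed_solution_unique[where E = "{}" and w = "\<lambda>_. 0"])
    show "continuous_on {s0..t} (\<zeta> i)" by (rule unreset_model_continuous[OF \<zeta> s0_ge])
    show "(\<zeta> i has_vector_derivative A *v \<zeta> i r + 0) (at r)" if "r \<in> {s0<..<t} - {}" for r
      using unreset_model_at[OF \<zeta>, of i r] s0_ge[of i] that by simp
  qed (use that Z Z0 contZ in auto)
  have x_eq: "x i t = X i t" if t: "s0 \<le> t" "t < \<theta>" for i t
  proof (rule perturbed_solution_unique[where E = "{}" and w = "\<lambda>r. B *v control_input c F G Z i r"])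
    show "continuous_on {s0..t} (x i)"
      using below_horizon[OF s0(1), of t] t T by (intro continuous_on_subset[OF state_continuous]) auto
    show "(x i has_vector_derivative A *v x i r + B *v control_input c F G Z i r) (at r)"
      if r: "r \<in> {s0<..<t} - {}" for r
    proof -
      have "y j r = Z j r" for j
        using y_model[OF last, of j r] after_last[of j r] s0_ge[of j] r t Z_eq[of r j] by (simp add: \<zeta>_def)
      then have "control_input c F G y i r = control_input c F G Z i r" by (rule control_input_cong)
      moreover have "r \<notin> ev j" for j using last_ge[of r j] s0_ge[of j] r by auto
      ultimately show ?thesis using state_derivative[of r i] r t s0 T by simp
    qed
  qed (use t X X0 contX in auto)

  \<comment> \<open>the agents that have an event at \<open>\<theta>\<close>, and the solution that starts after their resets\<close>
  define H where "H = {i. norm (\<zeta> i \<theta> - X i \<theta>) = thr \<theta>}"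
  obtain X' Z' where X'0: "\<And>i. X' i \<theta> = X i \<theta>" and Z'0: "\<And>i. Z' i \<theta> = (if i \<in> H then X i \<theta> else \<zeta> i \<theta>)"
    and Z': "\<And>i t. (Z' i has_vector_derivative A *v Z' i t) (at t)"
    and X': "\<And>i t. (X' i has_vector_derivative A *v X' i t + B *v control_input c F G Z' i t) (at t)"
    using closed_loop_solution[of \<theta> "\<lambda>i. X i \<theta>" "\<lambda>i. if i \<in> H then X i \<theta> else \<zeta> i \<theta>" A B c F G] by metis
  have contX': "continuous_on U (X' i)" for U i
    by (rule continuous_on_vector_derivative[OF has_vector_derivative_at_within[OF X']])
  have contZ': "continuous_on U (Z' i)" for U i
    by (rule continuous_on_vector_derivative[OF has_vector_derivative_at_within[OF Z']])
  have Z'_eq: "Z' i t = \<zeta> i t" if "\<theta> \<le> t" "i \<notin> H" for i t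
  proof (rule perturbed_solution_unique[where E = "{}" and w = "\<lambda>_. 0"])
    have l: "last i < \<theta>" using range[OF last] by auto
    then show "continuous_on {\<theta>..t} (\<zeta> i)" by (intro unreset_model_continuous[OF \<zeta>]) simp
    show "(\<zeta> i has_vector_derivative A *v \<zeta> i r + 0) (at r)" if "r \<in> {\<theta><..<t} - {}" for r
      using unreset_model_at[OF \<zeta>, of i r] l that by simp
  qed (use that Z' Z'0 contZ' in auto)
  \<comment> \<open>Without an event at \<open>\<theta>\<close> the old solution just goes on; this makes the extended state differentiable
    at \<open>\<theta>\<close>, as an execution requires there.\<close>
  have X'_eq: "X' i t = X i t" if "\<theta> \<le> t" "H = {}" for i t
  proof (rule perturbed_solution_unique[where E = "{}" and w = "\<lambda>r. B *v control_input c F G Z i r"])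
    fix r assume r: "r \<in> {\<theta><..<t} - {}"
    have "Z' j r = Z j r" for j using Z'_eq[of r j] Z_eq[of r j] r that s0 by simp
    then have "control_input c F G Z' i r = control_input c F G Z i r" by (rule control_input_cong)
    then show "(X' i has_vector_derivative A *v X' i r + B *v control_input c F G Z i r) (at r)"
      using X'[of i r] by simp
  qed (use that X X'0 contX contX' in auto)

  obtain b where b: "\<theta> < b" and no_hit: "\<And>i r. \<theta> < r \<Longrightarrow> r < b \<Longrightarrow> norm (Z' i r - X' i r) \<noteq> thr r"
  proof -
    have "eventually (\<lambda>r. norm (Z' i r - X' i r) - thr r \<noteq> 0) (at_right \<theta>)" for i
    proof (rule tendsto_imp_eventually_ne)
      have "continuous_on UNIV (\<lambda>r. norm (Z' i r - X' i r) - thr r)"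
        by (intro continuous_intros contX' contZ' thr_continuous)
      then show "((\<lambda>r. norm (Z' i r - X' i r) - thr r) \<longlongrightarrow> norm (Z' i \<theta> - X' i \<theta>) - thr \<theta>) (at_right \<theta>)"
        by (simp add: continuous_on_def filterlim_at_split)
      show "norm (Z' i \<theta> - X' i \<theta>) - thr \<theta> \<noteq> 0"
        using thr_pos[of \<theta>] by (auto simp: Z'0 X'0 H_def)
    qed
    then have "eventually (\<lambda>r. \<forall>i. norm (Z' i r - X' i r) - thr r \<noteq> 0) (at_right \<theta>)"
      by (intro eventually_all_finite) auto
    then obtain b where "\<theta> < b" "\<And>r. \<theta> < r \<Longrightarrow> r < b \<Longrightarrow> \<forall>i. norm (Z' i r - X' i r) - thr r \<noteq> 0"
      unfolding eventually_at_right_field by auto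
    then show thesis by (intro that[of b]) auto
  qed

  define x' where "x' i t = (if t < \<theta> then x i t else X' i t)" for i t
  define y' where "y' i t = (if t < \<theta> then y i t else Z' i t)" for i t
  define ev' where "ev' i = (if i \<in> H then insert \<theta> (ev i) else ev i)" for i
  have ev'_lt: "t \<in> ev' i \<longleftrightarrow> t \<in> ev i" if "t < \<theta>" for i t using that by (auto simp: ev'_def)
  have ev'_eq: "\<theta> \<in> ev' i \<longleftrightarrow> i \<in> H" for i using range[of \<theta> i] by (auto simp: ev'_def)
  have ev'_gt: "t \<notin> ev' i" if "\<theta> < t" for i t using range[of t i] that by (auto simp: ev'_def)
  have x'_mid: "x' i t = X i t" if "s0 \<le> t" "t \<le> \<theta>" for i t
    using that x_eq[of t i] X'0[of i] by (cases "t = \<theta>") (auto simp: x'_def)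

  have cont: "continuous_on {t. 0 \<le> t \<and> ereal t < ereal b} (x' i)" for i
  proof -
    have "continuous_on {0..s0} (x' i)"
    proof (rule continuous_on_eq)
      show "continuous_on {0..s0} (x i)"
        using below_horizon[OF order_refl, of s0] s0 T by (intro continuous_on_subset[OF state_continuous]) auto
    qed (use s0 in \<open>auto simp: x'_def\<close>)
    moreover have "continuous_on {s0..\<theta>} (x' i)"
      by (rule continuous_on_eq[OF contX]) (use x'_mid in auto)
    moreover have "continuous_on {\<theta>..} (x' i)"
      by (rule continuous_on_eq[OF contX']) (auto simp: x'_def)
    ultimately have "continuous_on ({0..s0} \<union> {s0..\<theta>} \<union> {\<theta>..}) (x' i)"
      by (intro continuous_on_closed_Un) auto
    then show ?thesis by (rule continuous_on_subset) auto
  qed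

  have deriv: "(x' i has_vector_derivative A *v x' i t + B *v control_input c F G y' i t) (at t)"
    if t: "0 \<le> t" "t < b" and no: "\<And>j. t \<notin> ev' j" for i t
  proof -
    consider "t < \<theta>" | "t = \<theta>" | "\<theta> < t" by linarith
    then show ?thesis
    proof cases
      case 1
      have "(x i has_vector_derivative A *v x i t + B *v control_input c F G y i t) (at t)"
        by (rule state_derivative) (use t 1 T no ev'_lt in auto)
      moreover have "control_input c F G y' i t = control_input c F G y i t"
        by (rule control_input_cong) (simp add: y'_def 1)
      ultimately have "(x i has_vector_derivative A *v x' i t + B *v control_input c F G y' i t) (at t)"
        by (simp add: x'_def 1)
      then show ?thesis
        by (rule has_vector_derivative_transform_within_open[where S = "{..<\<theta>}"]) (use 1 in \<open>auto simp: x'_def\<close>)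
    next
      case 2
      then have "H = {}" using no ev'_eq by auto
      have "control_input c F G y' i t = control_input c F G Z i t"
        by (rule control_input_cong) (use 2 Z'_eq Z_eq s0 \<open>H = {}\<close> in \<open>auto simp: y'_def\<close>)
      then have "(X i has_vector_derivative A *v x' i t + B *v control_input c F G y' i t) (at t)"
        using X[of i t] 2 by (simp add: x'_def X'0)
      then show ?thesis
        by (rule has_vector_derivative_transform_within_open[where S = "{s0<..}"])
           (use 2 s0 x_eq X'_eq \<open>H = {}\<close> in \<open>auto simp: x'_def\<close>)
    next
      case 3
      have "control_input c F G y' i t = control_input c F G Z' i t"
        by (rule control_input_cong) (use 3 in \<open>auto simp: y'_def\<close>)
      then have "(X' i has_vector_derivative A *v x' i t + B *v control_input c F G y' i t) (at t)"
        using X'[of i t] 3 by (simp add: x'_def)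
      then show ?thesis
        by (rule has_vector_derivative_transform_within_open[where S = "{\<theta><..}"])
           (use 3 in \<open>auto simp: x'_def\<close>)
    qed
  qed

  have old_y: "y' i t = model i s t" if "s \<in> ev i" "s \<le> t" "ev' i \<inter> {s<..t} = {}" for i s t
  proof (cases "t < \<theta>")
    case True
    have "r \<notin> ev i" if "s < r" "r \<le> t" for r
      using \<open>ev' i \<inter> {s<..t} = {}\<close> ev'_lt[of r i] that True by auto
    then have "ev i \<inter> {s<..t} = {}" by auto
    then show ?thesis using y_model[OF that(1,2) True] True by (simp add: y'_def)
  next
    case False
    have "s = last i"
    proof (rule ccontr)
      assume "s \<noteq> last i"
      then have "last i \<in> ev' i \<inter> {s<..t}"
        using last[of i] last_ge[OF that(1)] range[OF last, of i] False ev'_lt[of "last i" i] by auto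
      then show False using that(3) by simp
    qed
    moreover have "i \<notin> H"
    proof
      assume "i \<in> H"
      then have "\<theta> \<in> ev' i \<inter> {s<..t}" using range[OF that(1)] False ev'_eq by auto
      then show False using that(3) by simp
    qed
    ultimately show ?thesis using False Z'_eq[of t i] by (simp add: y'_def \<zeta>_def)
  qed

  have old_hit: "consecutive_events (ev' i) s t \<longleftrightarrow> first_hitting (\<lambda>r. norm (model i s r - x' i r)) thr s t"
    if s: "s \<in> ev i" and t: "s < t" "t < b" for i s t
  proof -
    let ?h = "\<lambda>r. norm (model i s r - x' i r)"
    have s': "s < \<theta>" "s \<in> ev' i" using range[OF s] s by (auto simp: ev'_def)
    have below: "first_hitting (\<lambda>r. norm (model i s r - x i r)) thr s r \<longleftrightarrow> first_hitting ?h thr s r" if "r < \<theta>" for r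
      by (rule first_hitting_cong) (use that in \<open>auto simp: x'_def\<close>)
    show ?thesis
    proof (cases "t < \<theta>")
      case True
      have "consecutive_events (ev' i) s t \<longleftrightarrow> consecutive_events (ev i) s t"
      proof -
        have "ev' i \<inter> {s<..<t} = ev i \<inter> {s<..<t}" using ev'_lt True by fastforce
        then show ?thesis using s' s ev'_lt[OF True] by (simp add: consecutive_events_def)
      qed
      then show ?thesis using hit[OF s t(1) True] below[OF True] by simp
    next
      case False
      show ?thesis
      proof (cases "s = last i")
        case False
        then have sl: "s < last i" using last_ge[OF s] by simp
        \<comment> \<open>\<open>s\<close> has a next event, before \<open>\<theta>\<close>; so neither side holds at the later time \<open>t\<close>\<close>
        let ?N = "ev i \<inter> {s<..}"
        define r where "r = Min ?N"
        have N: "finite ?N" "?N \<noteq> {}" using fin sl last by auto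
        have r: "r \<in> ?N" unfolding r_def by (rule Min_in[OF N])
        have "r \<le> q" if "q \<in> ?N" for q unfolding r_def using that by (rule Min_le[OF N(1)])
        then have "consecutive_events (ev i) s r"
          using r s by (fastforce simp: consecutive_events_def)
        moreover have r\<theta>: "r < \<theta>" using r range by auto
        ultimately have "?h r = thr r" using hit[OF s, of r] r below[of r] by (auto simp: first_hitting_def)
        then have "\<not> first_hitting ?h thr s t"
          using r r\<theta> \<open>\<not> t < \<theta>\<close> by (auto simp: first_hitting_def)
        moreover have "\<not> consecutive_events (ev' i) s t"
        proof
          assume "consecutive_events (ev' i) s t"
          moreover have "r \<in> ev' i \<inter> {s<..<t}" using r r\<theta> ev'_lt \<open>\<not> t < \<theta>\<close> by auto
          ultimately show False by (auto simp: consecutive_events_def)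
        qed
        ultimately show ?thesis by simp
      next
        case True
        have early: "?h r \<noteq> thr r" if "s < r" "r < \<theta>" for r
        proof -
          have "norm (model i s r - x i r) < thr r"
            by (rule error_below_threshold_until_event[OF s unreset[OF s]])
               (use hit[OF s] that T after_last[of i r] True in auto)
          then show ?thesis using that by (simp add: x'_def)
        qed
        have h\<theta>: "?h \<theta> = thr \<theta> \<longleftrightarrow> i \<in> H"
          using True by (simp add: H_def \<zeta>_def x'_def X'0)
        show ?thesis
        proof (cases "t = \<theta>")
          case t\<theta>: True
          have "ev' i \<inter> {s<..<\<theta>} = {}" using ev'_lt last_ge[of _ i] True by fastforce
          then have "consecutive_events (ev' i) s t \<longleftrightarrow> i \<in> H"
            using s' ev'_eq t\<theta> by (auto simp: consecutive_events_def)
          then show ?thesis using h\<theta> early t\<theta> s' by (auto simp: first_hitting_def)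
        next
          case False
          then have t\<theta>: "\<theta> < t" using \<open>\<not> t < \<theta>\<close> by simp
          have "\<not> first_hitting ?h thr s t"
          proof (cases "i \<in> H")
            case True
            then show ?thesis using h\<theta> s' t\<theta> by (auto simp: first_hitting_def)
          next
            case False
            then have "?h t = norm (Z' i t - X' i t)"
              using True t\<theta> Z'_eq[of t i] by (simp add: \<zeta>_def x'_def)
            then show ?thesis using no_hit[OF t\<theta> t(2), of i] by (simp add: first_hitting_def)
          qed
          then show ?thesis using ev'_gt[OF t\<theta>] by (simp add: consecutive_events_def)
        qed
      qed
    qed
  qed

  have new: "\<exists>z. unreset_model A s (x' i s) z \<and>
        (\<forall>t\<ge>s. ereal t < ereal b \<and> ev' i \<inter> {s<..t} = {} \<longrightarrow> y' i t = z t) \<and>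
        (\<forall>t>s. ereal t < ereal b \<longrightarrow>
           (consecutive_events (ev' i) s t \<longleftrightarrow> first_hitting (\<lambda>r. norm (z r - x' i r)) thr s t))"
    if s: "s \<in> ev' i" for i s
  proof (cases "s \<in> ev i")
    case True
    then have "x' i s = x i s" using range by (simp add: x'_def)
    then show ?thesis
      using unreset[OF True] old_y[OF True] old_hit[OF True] by (intro exI[of _ "model i s"]) auto
  next
    case False
    then have s\<theta>: "s = \<theta>" and iH: "i \<in> H" using s by (auto simp: ev'_def split: if_splits)
    have "unreset_model A s (x' i s) (Z' i)"
      using s\<theta> iH by (auto simp: unreset_model_def Z'0 x'_def X'0 intro: has_vector_derivative_at_within Z')
    moreover have "y' i t = Z' i t" if "s \<le> t" for t using that s\<theta> by (simp add: y'_def)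
    moreover have "\<not> consecutive_events (ev' i) s t" if "s < t" for t
      using ev'_gt[of t i] that s\<theta> by (simp add: consecutive_events_def)
    moreover have "\<not> first_hitting (\<lambda>r. norm (Z' i r - x' i r)) thr s t" if "s < t" "t < b" for t
      using no_hit[of t i] that s\<theta> by (simp add: first_hitting_def x'_def)
    ultimately show ?thesis by (intro exI[of _ "Z' i"]) auto
  qed

  have "execution A B F c G thr (ereal b) x' y' ev'"
    unfolding execution_def
  proof (intro conjI allI ballI impI)
    show "0 < ereal b" using s0 b by simp
    show "0 \<in> ev' i" for i using zero_event by (auto simp: ev'_def)
    show "ev' i \<subseteq> {t. 0 \<le> t \<and> ereal t < ereal b}" for i
    proof
      fix t assume "t \<in> ev' i"
      then have "t = \<theta> \<or> t \<in> ev i" by (auto simp: ev'_def split: if_splits)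
      then show "t \<in> {t. 0 \<le> t \<and> ereal t < ereal b}" using range[of t i] s0 b by auto
    qed
    show "finite (ev' i \<inter> {..s})" for i s using fin by (auto simp: ev'_def)
    show "continuous_on {t. 0 \<le> t \<and> ereal t < ereal b} (x' i)" for i by (rule cont)
    show "(x' i has_vector_derivative A *v x' i t + B *v control_input c F G y' i t) (at t)"
      if "0 \<le> t \<and> ereal t < ereal b \<and> (\<forall>j. t \<notin> ev' j)" for i t
      using that by (intro deriv) auto
  qed (rule new)
  moreover have "T < ereal b" using T b by simp
  moreover have "x' i t = x i t \<and> y' i t = y i t \<and> (t \<in> ev' i \<longleftrightarrow> t \<in> ev i)" if "ereal t < T" for i t
    using that T ev'_lt by (simp add: x'_def y'_def)
  ultimately show ?thesis by blast
qed

end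

section \<open>Consensus and exclusion of Zeno behavior\<close>

text \<open>The points before \<open>\<theta> - \<delta>\<close> are finitely many, and at most one further point fits below \<open>\<theta>\<close>.\<close>

lemma finite_if_separated:
  fixes S :: "real set"
  assumes "S \<subseteq> {..<\<theta>}" and fin: "\<And>s. s < \<theta> \<Longrightarrow> finite (S \<inter> {..s})" and "0 < \<delta>"
    and gap: "\<And>s t. consecutive_events S s t \<Longrightarrow> \<delta> \<le> t - s"
  shows "finite S"
proof -
  have sep: "\<delta> \<le> t - s" if "s \<in> S" "t \<in> S" "s < t" for s t
  proof -
    let ?N = "S \<inter> {..t} \<inter> {s<..}"
    have N: "finite ?N" "?N \<noteq> {}" using fin[of t] assms(1) that by auto
    have Min: "Min ?N \<in> ?N" by (rule Min_in[OF N])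
    have "Min ?N \<le> q" if "q \<in> ?N" for q using that by (rule Min_le[OF N(1)])
    then have "consecutive_events S s (Min ?N)"
      using Min \<open>s \<in> S\<close> by (fastforce simp: consecutive_events_def)
    from gap[OF this] Min show ?thesis by auto
  qed
  have "finite (S \<inter> {\<theta> - \<delta><..})"
  proof (cases "S \<inter> {\<theta> - \<delta><..} = {}")
    case False
    then obtain q where q: "q \<in> S" "\<theta> - \<delta> < q" by auto
    have "r = q" if "r \<in> S" "\<theta> - \<delta> < r" for r
      using sep[of r q] sep[of q r] q that assms(1) by (cases r q rule: linorder_cases) auto
    then have "S \<inter> {\<theta> - \<delta><..} \<subseteq> {q}" by auto
    then show ?thesis by (rule finite_subset) simp
  qed simp
  moreover have "finite (S \<inter> {..\<theta> - \<delta>})" by (rule fin) (use \<open>0 < \<delta>\<close> in simp)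
  moreover have "S = (S \<inter> {..\<theta> - \<delta>}) \<union> (S \<inter> {\<theta> - \<delta><..})" by auto
  ultimately show ?thesis by (metis finite_UnI)
qed

text \<open>Solving the inequality for the gap \<open>\<delta>\<close>. That the left-hand side is positive forces \<open>K\<close> to be positive.\<close>

lemma gap_lower_bound:
  fixes \<beta> K p \<delta> :: real
  assumes "0 < \<beta>" "0 < p" "0 < \<delta>" "\<beta> \<le> K * (exp (p * \<delta>) - 1)"
  shows "0 < K" "0 < ln (1 + \<beta> / K) / p" "ln (1 + \<beta> / K) / p \<le> \<delta>"
proof -
  have E: "0 < exp (p * \<delta>) - 1" using assms by simp
  show K: "0 < K"
  proof (rule ccontr)
    assume "\<not> 0 < K"
    then have "K * (exp (p * \<delta>) - 1) \<le> 0" using E by (intro mult_nonpos_nonneg) auto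
    with assms show False by simp
  qed
  then show "0 < ln (1 + \<beta> / K) / p" using assms(1,2) by (intro divide_pos_pos ln_gt_zero) simp_all
  have "1 + \<beta> / K \<le> exp (p * \<delta>)" using assms K by (simp add: field_simps)
  then have "ln (1 + \<beta> / K) \<le> ln (exp (p * \<delta>))" using K assms by (subst ln_le_cancel_iff) (auto intro: add_pos_pos)
  then show "ln (1 + \<beta> / K) / p \<le> \<delta>" using assms by (simp add: field_simps)
qed

context decaying_execution
begin

lemma rate_pos: "0 < mat_norm A + lamh" "0 < mat_norm A + lam"
  using mat_norm_nonneg[of A] lam by simp_all

lemma event_gap:
  assumes "consecutive_events (ev i) s t"
  shows "0 < K3 s" "0 < ln (1 + \<beta> / K3 s) / (mat_norm A + lamh)"
    "ln (1 + \<beta> / K3 s) / (mat_norm A + lamh) \<le> t - s"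
proof -
  have "0 < t - s" using assms by (simp add: consecutive_events_def)
  note * = gap_lower_bound[OF beta rate_pos(1) this threshold_le_gap[OF assms]]
  show "0 < K3 s" "0 < ln (1 + \<beta> / K3 s) / (mat_norm A + lamh)"
    "ln (1 + \<beta> / K3 s) / (mat_norm A + lamh) \<le> t - s"
    by (rule *)+
qed

text \<open>\<open>K3\<close> depends on the time of the event only through a decreasing exponential, so it is bounded on the nonnegative times.\<close>

lemma uniform_event_gap:
  obtains \<delta> where "0 < \<delta>" "\<And>i s t. consecutive_events (ev i) s t \<Longrightarrow> \<delta> \<le> t - s"
proof -
  define k where "k = mat_norm (c *\<^sub>R (B ** F))"
  \<comment> \<open>the summand \<open>1\<close> keeps \<open>M\<close> positive even if the bound on \<open>K3\<close> vanishes\<close>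
  define M where "M = k * (\<bar>K1\<bar> / (mat_norm A + lamh) + K2 / (mat_norm A + lam)) + 1"
  have k: "0 \<le> k" unfolding k_def by (rule mat_norm_nonneg)
  have M: "0 < M" unfolding M_def using k rate_pos K2_nonneg by (intro add_nonneg_pos mult_nonneg_nonneg) auto
  have "ln (1 + \<beta> / M) / (mat_norm A + lamh) \<le> t - s" if ce: "consecutive_events (ev i) s t" for i s t
  proof -
    have st: "0 < t - s" "0 \<le> s" using ce event_range by (auto simp: consecutive_events_def)
    have "K1 * exp ((lam - lamh) * s) \<le> \<bar>K1\<bar> * 1"
      using lam st by (intro mult_mono) (auto simp: mult_nonpos_nonneg)
    then have "K3 s \<le> M - 1"
      unfolding K3 M_def k_def[symmetric] using k rate_pos
      by (simp add: mult_left_mono divide_right_mono)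
    then have "K3 s * (exp ((mat_norm A + lamh) * (t - s)) - 1) \<le> M * (exp ((mat_norm A + lamh) * (t - s)) - 1)"
      using st rate_pos by (intro mult_right_mono) auto
    with threshold_le_gap[OF ce] have "\<beta> \<le> M * (exp ((mat_norm A + lamh) * (t - s)) - 1)" by simp
    from gap_lower_bound(3)[OF beta rate_pos(1) st(1) this] show ?thesis .
  qed
  moreover have "0 < ln (1 + \<beta> / M) / (mat_norm A + lamh)"
    using beta M rate_pos by (intro divide_pos_pos ln_gt_zero) simp_all
  ultimately show thesis using that by blast
qed

text \<open>Separated events cannot accumulate at a finite horizon, and finitely many events do not stop an
execution.\<close>

lemma extendable_if_finite_horizon:
  assumes "T \<noteq> \<infinity>"
  shows "\<exists>T' x' y' ev'. T < T' \<and> execution A B F c G (\<lambda>t. \<beta> * exp (- lam * t)) T' x' y' ev' \<and>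
    (\<forall>i t. 0 \<le> t \<and> ereal t < T \<longrightarrow> x' i t = x i t \<and> y' i t = y i t \<and> (t \<in> ev' i \<longleftrightarrow> t \<in> ev i))"
proof -
  have "0 < T" using execution by (simp add: execution_def)
  with assms obtain \<theta> where T: "T = ereal \<theta>" by (cases T) auto
  obtain \<delta> where \<delta>: "0 < \<delta>" "\<And>i s t. consecutive_events (ev i) s t \<Longrightarrow> \<delta> \<le> t - s"
    by (rule uniform_event_gap) blast
  have "finite (ev i)" for i
  proof (rule finite_if_separated[OF _ _ \<delta>(1) \<delta>(2)])
    show "ev i \<subseteq> {..<\<theta>}" using event_range T by auto
    show "finite (ev i \<inter> {..s})" if "s < \<theta>" for s using finite_events that T by simp
  qed
  with T show ?thesis by (rule extendable_beyond_finite_horizon)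
qed

lemma tail_tendsto_0:
  assumes T: "T = \<infinity>"
  shows "((\<lambda>t. norm (tail t)) \<longlongrightarrow> 0) at_top"
proof -
  have exp: "((\<lambda>t. exp (- a * t)) \<longlongrightarrow> 0) at_top" if "0 < a" for a :: real
    by (rule filterlim_compose[OF exp_at_bot filterlim_tendsto_neg_mult_at_bot[OF tendsto_const _ filterlim_ident]])
       (use that in simp)
  let ?D = "sqrt (real CARD('N)) * \<beta> * betah * mat_norm Bhat / (lamh - lam)"
  let ?U = "\<lambda>t. betah * norm (tail 0) * exp (- lamh * t) + ?D * (exp (- lam * t) - exp (- lamh * t))"
  have "(?U \<longlongrightarrow> betah * norm (tail 0) * 0 + ?D * (0 - 0)) at_top"
    using lam by (intro tendsto_intros exp) auto
  then have "(?U \<longlongrightarrow> 0) at_top" by simp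
  moreover have "\<forall>\<^sub>F t in at_top. norm (tail t) \<le> ?U t"
    using eventually_ge_at_top[of 0]
  proof eventually_elim
    case (elim t)
    then show ?case by (intro norm_tail_le) (simp_all add: T)
  qed
  ultimately show ?thesis
    by (intro tendsto_norm_zero Lim_null_comparison[where f = tail])
qed

text \<open>In \<open>x = S xhat\<close> the first coordinate contributes a multiple of the first column of \<open>S\<close>. This column is in the
kernel of the Laplacian and hence constant, so it cancels in differences of agents; what remains
is a fixed linear image of the tail coordinates, which tend to \<open>0\<close>.\<close>

lemma consensus:
  assumes T: "T = \<infinity>" and tree: "has_directed_spanning_tree G"
  shows "((\<lambda>t. norm (x i t - x j t)) \<longlongrightarrow> 0) at_top"
proof -
  define Q where "Q = (\<chi> i p. S $ i $ Some p)"
  have const: "S $ i $ None = S $ j $ None"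
    using complex_laplacian_kernel_constant[OF tree first_column_kernel[OF S SJ], of i j] by simp
  have le: "norm (x i t - x j t) \<le> 2 * mat_norm Q * norm (tail t)" for t
  proof -
    let ?w = "kron Q (mat 1 :: complex^'n^'n) *v tail t"
    \<comment> \<open>the first of the transformed coordinates, which need not tend to \<open>0\<close>\<close>
    define \<xi> where "\<xi> q = (\<Sum>l\<in>UNIV. matrix_inv S $ None $ l * state t $ (l, q))" for q
    have "S ** matrix_inv S = (\<chi> i l. S $ i $ None * matrix_inv S $ None $ l) + Q ** tail_rows S"
      by (simp add: Finite_Cartesian_Product.vec_eq_iff matrix_matrix_mult_def UNIV_option_sum Q_def tail_rows_def)
    then have split: "mat 1 = (\<chi> i l. S $ i $ None * matrix_inv S $ None $ l) + Q ** tail_rows S"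
      by (simp add: invertible_matrix_inv[OF S])
    have w: "?w = kron (Q ** tail_rows S) (mat 1) *v state t"
      by (simp add: tail_eq matrix_vector_mul_assoc kron_mult)
    have decomp: "state t $ (i, q) = S $ i $ None * \<xi> q + ?w $ (i, q)" for i q
    proof -
      have "state t $ (i, q) = (kron (mat 1) (mat 1) *v state t) $ (i, q)"
        by (simp add: kron_mat_1)
      also have "\<dots> = S $ i $ None * \<xi> q + ?w $ (i, q)"
        unfolding w by (subst split) (simp add: kron_id_vector_nth \<xi>_def sum_distrib_left sum.distrib distrib_right mult.assoc)
      finally show ?thesis .
    qed
    have "complex_of_real ((x i t - x j t) $ q) = ?w $ (i, q) - ?w $ (j, q)" for q
      using decomp[of i q] decomp[of j q] const by (simp add: state_def stack_def)
    then have "norm (x i t - x j t) = norm ((\<chi> q. ?w $ (i, q)) - (\<chi> q. ?w $ (j, q)))"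
      by (simp add: norm_vec_def flip: norm_of_real[where 'a = complex])
    also have "\<dots> \<le> norm (\<chi> q. ?w $ (i, q)) + norm (\<chi> q. ?w $ (j, q))" by (rule norm_triangle_ineq4)
    also have "\<dots> \<le> norm ?w + norm ?w" by (intro add_mono norm_block_le)
    also have "\<dots> \<le> mat_norm Q * norm (tail t) + mat_norm Q * norm (tail t)"
      by (intro add_mono norm_kron_id_le)
    finally show ?thesis by simp
  qed
  have "((\<lambda>t. 2 * mat_norm Q * norm (tail t)) \<longlongrightarrow> 2 * mat_norm Q * 0) at_top"
    by (intro tendsto_intros tail_tendsto_0 T)
  then have "((\<lambda>t. 2 * mat_norm Q * norm (tail t)) \<longlongrightarrow> 0) at_top" by simp
  then show ?thesis
    by (rule tendsto_sandwich[OF _ _ tendsto_const, rotated 2]) (simp_all add: le)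
qed

end

theorem theorem1:
  fixes A :: "real^'n^'n" and B :: "real^'m^'n" and F :: "real^'n^'m" and P :: "real^'n^'n"
    and G :: "('N::finite \<times> 'N) set"
    and S\<^sub>L :: "complex^('k::finite option)^'N" and J :: "complex^'k^'k"
    and Ahat :: "complex^('k \<times> 'n)^('k \<times> 'n)" and Bhat :: "complex^('N \<times> 'n)^('k \<times> 'n)"
    and lam2 :: complex
    and c \<alpha> betah lamh \<beta> lam xhat0 Thetah K1 K2 :: real
    and K3 \<tau> :: "real \<Rightarrow> real"
    and T :: ereal and x y :: "'N \<Rightarrow> real \<Rightarrow> real^'n" and ev :: "'N \<Rightarrow> real set"
  assumes "CARD('N) \<ge> 2" and "CARD('N) = CARD('k) + 1"
    and "has_directed_spanning_tree G"
    and "controllable A B"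
    and "invertible S\<^sub>L"
    and "matrix_inv S\<^sub>L ** cmat (laplacian G) ** S\<^sub>L = block_zero J"
    and "jordan_form_nonzero J"
    and "mat_eigenvalue (cmat (laplacian G)) lam2" and "lam2 \<noteq> 0"
    and "\<forall>\<mu>. mat_eigenvalue (cmat (laplacian G)) \<mu> \<and> \<mu> \<noteq> 0 \<longrightarrow> Re lam2 \<le> Re \<mu>"
    and "\<alpha> > 0" and "pos_definite P"
    and "neg_definite (P ** A + transpose A ** P
           - 2 *\<^sub>R (P ** B ** transpose B ** P) + (2 * \<alpha>) *\<^sub>R P)"
    and "F = - (transpose B ** P)"
    and "c \<ge> 1 / Re lam2"
    and "Ahat = kron (mat 1) (cmat A) + kron (c *\<^sub>R J) (cmat (B ** F))"
    and "betah > 0" and "lamh > 0"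
    and "\<forall>t\<ge>0. mat_norm (mat_exp (t *\<^sub>R Ahat)) \<le> betah * exp (- lamh * t)"
    and "\<beta> > 0" and "0 < lam" and "lam < lamh"
    and "maximal_execution A B F c G (\<lambda>t. \<beta> * exp (- lam * t)) T x y ev"
    and "xhat0 = norm (xhat_tail S\<^sub>L (\<lambda>i. x i 0))"
    and "Bhat = kron (c *\<^sub>R Delta_mat S\<^sub>L J) (cmat (B ** F))"
    and "Thetah = mat_norm (Theta_mat S\<^sub>L J)"
    and "K1 = Thetah * (betah * xhat0
           - sqrt (real CARD('N)) * \<beta> * betah * mat_norm Bhat / (lamh - lam))"
    and "K2 = Thetah * (sqrt (real CARD('N)) * \<beta> * betah * mat_norm Bhat / (lamh - lam))
           + mat_norm (laplacian G) * sqrt (real CARD('N)) * \<beta>"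
    and "K3 = (\<lambda>s. mat_norm (c *\<^sub>R (B ** F)) *
           (K1 * exp ((lam - lamh) * s) / (mat_norm A + lamh) + K2 / (mat_norm A + lam)))"
    and "\<tau> = (\<lambda>s. ln (1 + \<beta> / K3 s) / (mat_norm A + lamh))"
  shows "T = \<infinity> \<and>
    (\<forall>i j. ((\<lambda>t. norm (x i t - x j t)) \<longlongrightarrow> 0) at_top) \<and>
    \<not> zeno ev \<and>
    (\<forall>i s t. consecutive_events (ev i) s t \<longrightarrow> 0 < K3 s \<and> 0 < \<tau> s \<and> \<tau> s \<le> t - s)"
proof -
  have ex: "execution A B F c G (\<lambda>t. \<beta> * exp (- lam * t)) T x y ev"
    using assms(23) by (simp add: maximal_execution_def)
  have dec: "decaying_execution A B F c G \<beta> lam T x y ev S\<^sub>L J betah lamh K1 K2 K3 Ahat Bhat"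
  proof (intro decaying_execution.intro triggered_execution.intro decaying_execution_axioms.intro)
    show "execution A B F c G (\<lambda>t. \<beta> * exp (- lam * t)) T x y ev" by (rule ex)
    show "0 < \<beta> * exp (- lam * t)" for t using assms(20) by simp
    show "continuous_on X (\<lambda>t. \<beta> * exp (- lam * t))" for X by (intro continuous_intros)
    show "invertible S\<^sub>L" "matrix_inv S\<^sub>L ** cmat (laplacian G) ** S\<^sub>L = block_zero J"
      by (rule assms(5,6))+
    show "Ahat = kron (mat 1) (cmat A) + kron (c *\<^sub>R J) (cmat (B ** F))"
      "Bhat = kron (c *\<^sub>R Delta_mat S\<^sub>L J) (cmat (B ** F))" by (rule assms(16,25))+
    show "mat_norm (mat_exp (t *\<^sub>R Ahat)) \<le> betah * exp (- lamh * t)" if "0 \<le> t" for t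
      by (rule assms(19)[rule_format, OF that])
    show "0 < betah" "0 < \<beta>" "0 < lam" "lam < lamh" by (rule assms(17,20-22))+
    show "K1 = mat_norm (Theta_mat S\<^sub>L J) * (betah * norm (xhat_tail S\<^sub>L (\<lambda>i. x i 0))
           - sqrt (real CARD('N)) * \<beta> * betah * mat_norm Bhat / (lamh - lam))"
      by (simp only: assms(24,26,27))
    show "K2 = mat_norm (Theta_mat S\<^sub>L J) * (sqrt (real CARD('N)) * \<beta> * betah * mat_norm Bhat / (lamh - lam))
           + mat_norm (laplacian G) * sqrt (real CARD('N)) * \<beta>"
      by (simp only: assms(26,28))
    show "K3 = (\<lambda>s. mat_norm (c *\<^sub>R (B ** F)) *
           (K1 * exp ((lam - lamh) * s) / (mat_norm A + lamh) + K2 / (mat_norm A + lam)))"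
      by (rule assms(29))
  qed
  have T: "T = \<infinity>"
  proof (rule ccontr)
    assume "T \<noteq> \<infinity>"
    from decaying_execution.extendable_if_finite_horizon[OF dec this]
    show False by (rule notE[OF assms(23)[unfolded maximal_execution_def, THEN conjunct2]])
  qed
  have "finite (ev i \<inter> {a..b})" for i a b
    by (rule finite_subset[OF _ triggered_execution.finite_events[OF decaying_execution.axioms(1)[OF dec], of b i]]) (auto simp: T)
  then have "\<not> zeno ev" by (simp add: zeno_def)
  then show ?thesis
    unfolding assms(30) by (intro conjI allI impI T decaying_execution.consensus[OF dec T assms(3)]
        decaying_execution.event_gap[OF dec])
qed

end
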